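(* Let $\mathcal{C}^0,\mathcal{C}'$ be triangulated subcategories of a triangulated category $\mathcal{C}$. Assume that $w^0$ is an essentially bounded below (resp. above, both) weight structure on $\mathcal{C}^0$, $w$ is its coproductive extension to $\mathcal{C}$, and there exists a $t$-structure $t$ on $\mathcal{C}'$ that is orthogonal to $w^0$ (in $\mathcal{C}$). Set $\mathcal{C}'^{0}_+$ (resp. $\mathcal{C}'^{0}_-$, $\mathcal{C}'^{0}_b$) to be the full subcategory of $\mathcal{C}'$ that consists of those $M\in\mathrm{Obj}\,\mathcal{C}'$ such that the functor $H_M^{\mathcal{C}^0}=\mathcal{C}(-,M)|_{\mathcal{C}^0}$ is locally bounded below (resp. above, both). Then the category $\mathcal{C}'^{0}_+$ (resp. $\mathcal{C}'^{0}_-$, $\mathcal{C}'^{0}_b$) is triangulated and $t$ restricts to it. Moreover, this restriction of $t$ is strictly orthogonal to $w^0$, and its heart coincides with $\underline{Ht}$.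
   Context: Conventions: subcategories are strictly full; $X\perp Y$ means $\mathcal{C}(X,Y)=0$, for classes $D\perp E$ means $X\perp Y$ for all $X\in D$, $Y\in E$; $D^{\perp}=\{Y\in\mathrm{Obj}\,\mathcal{C}:\ X\perp Y\ \forall X\in D\}$. A class $\mathcal{P}$ of objects is extension-closed if $0\in\mathcal{P}$ and for any distinguished triangle $A\to C\to B\to A[1]$ with $A,B\in\mathcal{P}$ also $C\in\mathcal{P}$. For a cohomological functor $H$ put $H^i(M)=H(M[-i])$; $H$ is locally bounded below (resp. above) if for every $M$ we have $H^i(M)=0$ for $i\ll 0$ (resp. $i\gg 0$). A weight structure $v=(\mathcal{E}_{v\le 0},\mathcal{E}_{v\ge 0})$ on a triangulated category $\mathcal{E}$ is a pair of classes of objects closed under retracts such that $\mathcal{E}_{v\le 0}\subset \mathcal{E}_{v\le 0}[1]$, $\mathcal{E}_{v\ge 0}[1]\subset \mathcal{E}_{v\ge 0}$, $\mathcal{E}_{v\le 0}\perp \mathcal{E}_{v\ge 0}[1]$, and every object $M$ fits into a distinguished triangle $L\to M\to R\to L[1]$ with $L\in \mathcal{E}_{v\le 0}$, $R\in\mathcal{E}_{v\ge 0}[1]$. $\mathcal{E}_{v\le i}=\mathcal{E}_{v\le 0}[i]$, $\mathcal{E}_{v\ge i}=\mathcal{E}_{v\ge 0}[i]$. An object is left (resp. right) degenerate if it lies in $\bigcap_{i\in\mathbb{Z}}\mathcal{E}_{v\ge i}$ (resp. $\bigcap_{i\in\mathbb{Z}}\mathcal{E}_{v\le i}$). $M$ is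 essentially $v$-positive if for $\tilde M=M\oplus M[1]$ there is a distinguished triangle $RD\to\tilde M\to Y\to RD[1]$ with $Y\in\mathcal{E}_{v\ge 0}$ and $RD$ right degenerate; $M$ is essentially $v$-negative if for $\tilde M=M\oplus M[-1]$ there is a distinguished triangle $X\to\tilde M\to LD\to X[1]$ with $X\in\mathcal{E}_{v\le 0}$ and $LD$ left degenerate. $v$ is essentially bounded below (resp. above) if for every $M\in\mathrm{Obj}\,\mathcal{E}$ there is $n\in\mathbb{Z}$ such that $M[-n]$ is essentially $v$-positive (resp. $v$-negative). The weight structure $w$ on $\mathcal{C}$ is the coproductive extension of $w^0$ if $\mathcal{C}_{w\le 0}$ (resp. $\mathcal{C}_{w\ge 0}$) is the smallest retraction-closed and extension-closed class of objects of $\mathcal{C}$ that is closed under those small coproducts that exist in $\mathcal{C}$ and contains $\mathcal{C}^0_{w^0\le 0}$ (resp. $\mathcal{C}^0_{w^0\ge 0}$). A $t$-structure $t=(\mathcal{C}'_{t\le 0},\mathcal{C}'_{t\ge 0})$ on $\mathcal{C}'$ (homological convention) is a pair of classes of objects closed under isomorphism such that $\mathcal{C}'_{t\le 0}\subset \mathcal{C}'_{t\le 0}[1]$, $\mathcal{C}'_{t\ge 0}[1]\subset \mathcal{C}'_{t\ge 0}$, $\mathcal{C}'_{t\ge 0}[1]\perp \mathcal{C}'_{t\le 0}$, and every object $M$ fits into a distinguished triangle $L_tM\to M\to R_tM\to L_tM[1]$ with $L_tM\in \mathcal{C}'_{t\ge 0}$, $R_tM\in\mathcal{C}'_{t\le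 0}[-1]$. $\mathcal{C}'_{t\le i}=\mathcal{C}'_{t\le 0}[i]$, $\mathcal{C}'_{t\ge i}=\mathcal{C}'_{t\ge 0}[i]$; $\underline{Ht}$ is the full subcategory with objects $\mathcal{C}'_{t\le 0}\cap \mathcal{C}'_{t\ge 0}$. $t$ restricts to a full triangulated subcategory $\mathcal{C}''$ if $(\mathcal{C}'_{t\le 0}\cap\mathrm{Obj}\,\mathcal{C}'',\mathcal{C}'_{t\ge 0}\cap\mathrm{Obj}\,\mathcal{C}'')$ is a $t$-structure on $\mathcal{C}''$. A $t$-structure $s$ on a triangulated subcategory $\mathcal{E}\subset\mathcal{C}$ is orthogonal to $w^0$ if $\mathcal{C}^0_{w^0\le 0}\perp\mathcal{E}_{s\ge 1}$ and $\mathcal{C}^0_{w^0\ge 0}\perp\mathcal{E}_{s\le -1}$; it is strictly orthogonal if $\mathcal{E}_{s\ge 1}=(\mathcal{C}^0_{w^0\le 0})^{\perp}\cap\mathrm{Obj}\,\mathcal{E}$ and $\mathcal{E}_{s\le -1}=(\mathcal{C}^0_{w^0\ge 0})^{\perp}\cap\mathrm{Obj}\,\mathcal{E}$. *)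

theory Defs
  imports "HOL-Algebra.Group"
begin

text \<open>
  \<open>Comp g f\<close> is "g after f"; \<open>Add\<close> and \<open>Zero X Y\<close> give the group structure on \<open>Hom X Y\<close>;
  \<open>Sh\<close> and \<open>ShM\<close> are the translation functor [1] on objects and on morphisms;
  \<open>Tri X Y Z f g h\<close> says that X --f--> Y --g--> Z --h--> X[1] is distinguished.
\<close>

record ('o, 'm) tcat =
  Ob   :: "'o set"
  Hom  :: "'o \<Rightarrow> 'o \<Rightarrow> 'm set"
  Comp :: "'m \<Rightarrow> 'm \<Rightarrow> 'm"
  Id   :: "'o \<Rightarrow> 'm"
  Add  :: "'m \<Rightarrow> 'm \<Rightarrow> 'm"
  Zero :: "'o \<Rightarrow> 'o \<Rightarrow> 'm"
  Sh   :: "'o \<Rightarrow> 'o"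
  ShM  :: "'m \<Rightarrow> 'm"
  Tri  :: "'o \<Rightarrow> 'o \<Rightarrow> 'o \<Rightarrow> 'm \<Rightarrow> 'm \<Rightarrow> 'm \<Rightarrow> bool"

locale category =
  fixes C :: "('o, 'm) tcat"
  assumes Hom_disjoint:
      "\<lbrakk>X \<in> Ob C; Y \<in> Ob C; X' \<in> Ob C; Y' \<in> Ob C; f \<in> Hom C X Y; f \<in> Hom C X' Y'\<rbrakk>
        \<Longrightarrow> X = X' \<and> Y = Y'"
    and Id_Hom: "X \<in> Ob C \<Longrightarrow> Id C X \<in> Hom C X X"
    and Comp_Hom:
      "\<lbrakk>X \<in> Ob C; Y \<in> Ob C; Z \<in> Ob C; f \<in> Hom C X Y; g \<in> Hom C Y Z\<rbrakk>
        \<Longrightarrow> Comp C g f \<in> Hom C X Z"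
    and Comp_Id_right: "\<lbrakk>X \<in> Ob C; Y \<in> Ob C; f \<in> Hom C X Y\<rbrakk> \<Longrightarrow> Comp C f (Id C X) = f"
    and Comp_Id_left: "\<lbrakk>X \<in> Ob C; Y \<in> Ob C; f \<in> Hom C X Y\<rbrakk> \<Longrightarrow> Comp C (Id C Y) f = f"
    and Comp_assoc:
      "\<lbrakk>W \<in> Ob C; X \<in> Ob C; Y \<in> Ob C; Z \<in> Ob C;
        f \<in> Hom C W X; g \<in> Hom C X Y; h \<in> Hom C Y Z\<rbrakk>
        \<Longrightarrow> Comp C h (Comp C g f) = Comp C (Comp C h g) f"

definition hom_group :: "('o, 'm) tcat \<Rightarrow> 'o \<Rightarrow> 'o \<Rightarrow> 'm monoid" where
  "hom_group C X Y = \<lparr>carrier = Hom C X Y, mult = Add C, one = Zero C X Y\<rparr>"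

definition iso_pair :: "('o, 'm) tcat \<Rightarrow> 'o \<Rightarrow> 'o \<Rightarrow> 'm \<Rightarrow> 'm \<Rightarrow> bool" where
  "iso_pair C X Y f g \<longleftrightarrow> f \<in> Hom C X Y \<and> g \<in> Hom C Y X \<and>
     Comp C g f = Id C X \<and> Comp C f g = Id C Y"

definition is_iso :: "('o, 'm) tcat \<Rightarrow> 'o \<Rightarrow> 'o \<Rightarrow> 'm \<Rightarrow> bool" where
  "is_iso C X Y f \<longleftrightarrow> (\<exists>g. iso_pair C X Y f g)"

definition isomorphic :: "('o, 'm) tcat \<Rightarrow> 'o \<Rightarrow> 'o \<Rightarrow> bool" where
  "isomorphic C X Y \<longleftrightarrow> (\<exists>f. is_iso C X Y f)"

definition retract_of :: "('o, 'm) tcat \<Rightarrow> 'o \<Rightarrow> 'o \<Rightarrow> bool" where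
  "retract_of C X Y \<longleftrightarrow> (\<exists>i \<in> Hom C X Y. \<exists>p \<in> Hom C Y X. Comp C p i = Id C X)"

definition zero_object :: "('o, 'm) tcat \<Rightarrow> 'o \<Rightarrow> bool" where
  "zero_object C Z \<longleftrightarrow> Z \<in> Ob C \<and>
     (\<forall>X \<in> Ob C. (\<exists>!f. f \<in> Hom C X Z) \<and> (\<exists>!f. f \<in> Hom C Z X))"

definition biproduct ::
  "('o, 'm) tcat \<Rightarrow> 'o \<Rightarrow> 'o \<Rightarrow> 'o \<Rightarrow> 'm \<Rightarrow> 'm \<Rightarrow> 'm \<Rightarrow> 'm \<Rightarrow> bool" where
  "biproduct C A B S i1 i2 p1 p2 \<longleftrightarrow>
     S \<in> Ob C \<and> i1 \<in> Hom C A S \<and> i2 \<in> Hom C B S \<and> p1 \<in> Hom C S A \<and> p2 \<in> Hom C S B \<and>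
     Comp C p1 i1 = Id C A \<and> Comp C p2 i2 = Id C B \<and>
     Comp C p1 i2 = Zero C B A \<and> Comp C p2 i1 = Zero C A B \<and>
     Add C (Comp C i1 p1) (Comp C i2 p2) = Id C S"

definition is_direct_sum :: "('o, 'm) tcat \<Rightarrow> 'o \<Rightarrow> 'o \<Rightarrow> 'o \<Rightarrow> bool" where
  "is_direct_sum C A B S \<longleftrightarrow> (\<exists>i1 i2 p1 p2. biproduct C A B S i1 i2 p1 p2)"

locale additive_category = category C for C :: "('o, 'm) tcat" +
  assumes hom_group: "\<lbrakk>X \<in> Ob C; Y \<in> Ob C\<rbrakk> \<Longrightarrow> comm_group (hom_group C X Y)"
    and Comp_Add_left:
      "\<lbrakk>X \<in> Ob C; Y \<in> Ob C; Z \<in> Ob C; f \<in> Hom C X Y; g \<in> Hom C Y Z; g' \<in> Hom C Y Z\<rbrakk>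
        \<Longrightarrow> Comp C (Add C g g') f = Add C (Comp C g f) (Comp C g' f)"
    and Comp_Add_right:
      "\<lbrakk>X \<in> Ob C; Y \<in> Ob C; Z \<in> Ob C; f \<in> Hom C X Y; f' \<in> Hom C X Y; g \<in> Hom C Y Z\<rbrakk>
        \<Longrightarrow> Comp C g (Add C f f') = Add C (Comp C g f) (Comp C g f')"
    and ex_zero_object: "\<exists>Z. zero_object C Z"
    and ex_direct_sum: "\<lbrakk>A \<in> Ob C; B \<in> Ob C\<rbrakk> \<Longrightarrow> \<exists>S. is_direct_sum C A B S"

locale triangulated_category = additive_category C for C :: "('o, 'm) tcat" +
  assumes Sh_bij: "bij_betw (Sh C) (Ob C) (Ob C)"
    and ShM_bij: "\<lbrakk>X \<in> Ob C; Y \<in> Ob C\<rbrakk>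
        \<Longrightarrow> bij_betw (ShM C) (Hom C X Y) (Hom C (Sh C X) (Sh C Y))"
    and ShM_Id: "X \<in> Ob C \<Longrightarrow> ShM C (Id C X) = Id C (Sh C X)"
    and ShM_Comp:
      "\<lbrakk>X \<in> Ob C; Y \<in> Ob C; Z \<in> Ob C; f \<in> Hom C X Y; g \<in> Hom C Y Z\<rbrakk>
        \<Longrightarrow> ShM C (Comp C g f) = Comp C (ShM C g) (ShM C f)"
    and ShM_Add:
      "\<lbrakk>X \<in> Ob C; Y \<in> Ob C; f \<in> Hom C X Y; f' \<in> Hom C X Y\<rbrakk>
        \<Longrightarrow> ShM C (Add C f f') = Add C (ShM C f) (ShM C f')"
    and Tri_typed:
      "Tri C X Y Z f g h \<Longrightarrow>
        X \<in> Ob C \<and> Y \<in> Ob C \<and> Z \<in> Ob C \<and>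
        f \<in> Hom C X Y \<and> g \<in> Hom C Y Z \<and> h \<in> Hom C Z (Sh C X)"
    and TR1_iso:
      "\<lbrakk>Tri C X Y Z f g h; X' \<in> Ob C; Y' \<in> Ob C; Z' \<in> Ob C;
        f' \<in> Hom C X' Y'; g' \<in> Hom C Y' Z'; h' \<in> Hom C Z' (Sh C X');
        is_iso C X X' a; is_iso C Y Y' b; is_iso C Z Z' c;
        Comp C b f = Comp C f' a; Comp C c g = Comp C g' b;
        Comp C (ShM C a) h = Comp C h' c\<rbrakk>
        \<Longrightarrow> Tri C X' Y' Z' f' g' h'"
    and TR1_Id:
      "\<lbrakk>X \<in> Ob C; zero_object C Z\<rbrakk>
        \<Longrightarrow> Tri C X X Z (Id C X) (Zero C X Z) (Zero C Z (Sh C X))"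
    and TR1_cone:
      "\<lbrakk>X \<in> Ob C; Y \<in> Ob C; f \<in> Hom C X Y\<rbrakk> \<Longrightarrow> \<exists>Z g h. Tri C X Y Z f g h"
    and TR2:
      "\<lbrakk>X \<in> Ob C; Y \<in> Ob C; Z \<in> Ob C;
        f \<in> Hom C X Y; g \<in> Hom C Y Z; h \<in> Hom C Z (Sh C X)\<rbrakk>
        \<Longrightarrow> Tri C X Y Z f g h \<longleftrightarrow>
            Tri C Y Z (Sh C X) g h (inv\<^bsub>hom_group C (Sh C X) (Sh C Y)\<^esub> (ShM C f))"
    and TR3:
      "\<lbrakk>Tri C X Y Z f g h; Tri C X' Y' Z' f' g' h';
        a \<in> Hom C X X'; b \<in> Hom C Y Y'; Comp C b f = Comp C f' a\<rbrakk>
        \<Longrightarrow> \<exists>c \<in> Hom C Z Z'. Comp C c g = Comp C g' b \<and> Comp C (ShM C a) h = Comp C h' c"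
    and TR4:
      "\<lbrakk>Tri C X Y U f a b; Tri C Y Z V g c d; Tri C X Z W (Comp C g f) e k\<rbrakk>
        \<Longrightarrow> \<exists>u v. Tri C U W V u v (Comp C (ShM C a) d) \<and>
              Comp C u a = Comp C e g \<and> Comp C k u = b \<and>
              Comp C v e = c \<and> Comp C d v = Comp C (ShM C f) k"

definition shift :: "('o, 'm) tcat \<Rightarrow> int \<Rightarrow> 'o \<Rightarrow> 'o" where
  "shift C i M = (if 0 \<le> i then (Sh C ^^ nat i) M
                  else (inv_into (Ob C) (Sh C) ^^ nat (- i)) M)"

text \<open>
  Subcategories are strictly full, hence given by their classes of objects.
  \<open>full_sub C D\<close> is the full subcategory with the inherited structure.
\<close>

definition full_sub :: "('o, 'm) tcat \<Rightarrow> 'o set \<Rightarrow> ('o, 'm) tcat" where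
  "full_sub C D = C\<lparr>Ob := D,
     Tri := (\<lambda>X Y Z f g h. X \<in> D \<and> Y \<in> D \<and> Z \<in> D \<and> Tri C X Y Z f g h)\<rparr>"

definition iso_closed :: "('o, 'm) tcat \<Rightarrow> 'o set \<Rightarrow> bool" where
  "iso_closed C P \<longleftrightarrow> P \<subseteq> Ob C \<and> (\<forall>X \<in> P. \<forall>Y \<in> Ob C. isomorphic C X Y \<longrightarrow> Y \<in> P)"

definition triangulated_subcategory :: "('o, 'm) tcat \<Rightarrow> 'o set \<Rightarrow> bool" where
  "triangulated_subcategory C D \<longleftrightarrow>
     iso_closed C D \<and>
     (\<forall>Z. zero_object C Z \<longrightarrow> Z \<in> D) \<and>
     (\<forall>X \<in> Ob C. Sh C X \<in> D \<longleftrightarrow> X \<in> D) \<and>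
     (\<forall>X Y Z f g h. Tri C X Y Z f g h \<and> X \<in> D \<and> Y \<in> D \<longrightarrow> Z \<in> D)"

definition perp :: "('o, 'm) tcat \<Rightarrow> 'o \<Rightarrow> 'o \<Rightarrow> bool" where
  "perp C X Y \<longleftrightarrow> Hom C X Y = {Zero C X Y}"

definition class_perp :: "('o, 'm) tcat \<Rightarrow> 'o set \<Rightarrow> 'o set \<Rightarrow> bool" where
  "class_perp C D E \<longleftrightarrow> (\<forall>X \<in> D. \<forall>Y \<in> E. perp C X Y)"

definition right_perp :: "('o, 'm) tcat \<Rightarrow> 'o set \<Rightarrow> 'o set" where
  "right_perp C D = {Y \<in> Ob C. \<forall>X \<in> D. perp C X Y}"

definition retract_closed :: "('o, 'm) tcat \<Rightarrow> 'o set \<Rightarrow> bool" where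
  "retract_closed C P \<longleftrightarrow> P \<subseteq> Ob C \<and> (\<forall>Y \<in> P. \<forall>X \<in> Ob C. retract_of C X Y \<longrightarrow> X \<in> P)"

definition extension_closed :: "('o, 'm) tcat \<Rightarrow> 'o set \<Rightarrow> bool" where
  "extension_closed C P \<longleftrightarrow> P \<subseteq> Ob C \<and> (\<forall>Z. zero_object C Z \<longrightarrow> Z \<in> P) \<and>
     (\<forall>A X B f g h. Tri C A X B f g h \<and> A \<in> P \<and> B \<in> P \<longrightarrow> X \<in> P)"

definition coproduct ::
  "('o, 'm) tcat \<Rightarrow> 'i set \<Rightarrow> ('i \<Rightarrow> 'o) \<Rightarrow> 'o \<Rightarrow> ('i \<Rightarrow> 'm) \<Rightarrow> bool" where
  "coproduct C I X S j \<longleftrightarrow>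
     S \<in> Ob C \<and> (\<forall>i \<in> I. X i \<in> Ob C \<and> j i \<in> Hom C (X i) S) \<and>
     (\<forall>Y \<in> Ob C. \<forall>f. (\<forall>i \<in> I. f i \<in> Hom C (X i) Y) \<longrightarrow>
        (\<exists>!g. g \<in> Hom C S Y \<and> (\<forall>i \<in> I. Comp C g (j i) = f i)))"

text \<open>
  HOL has no universe of small sets, so the collection \<open>U\<close> of those index sets that count as
  small is a parameter. No closure property is asked of it; any reading of "small" (for instance
  all sets below a given cardinal, or \<open>UNIV\<close> for a large enough index type) is an instance.
\<close>

definition coproduct_closed :: "'i set set \<Rightarrow> ('o, 'm) tcat \<Rightarrow> 'o set \<Rightarrow> bool" where
  "coproduct_closed U C P \<longleftrightarrow>
     (\<forall>I \<in> U. \<forall>X S j. (\<forall>i \<in> I. X i \<in> P) \<and> coproduct C I X S j \<longrightarrow> S \<in> P)"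

text \<open>The three closure properties are stable under intersection, so this is the smallest class.\<close>

definition coproductive_hull :: "'i set set \<Rightarrow> ('o, 'm) tcat \<Rightarrow> 'o set \<Rightarrow> 'o set" where
  "coproductive_hull U C G =
     \<Inter> {P. retract_closed C P \<and> extension_closed C P \<and> coproduct_closed U C P \<and> G \<subseteq> P}"

text \<open>
  A weight structure or t-structure v on E is the pair \<open>(E_{v \<le> 0}, E_{v \<ge> 0})\<close>;
  \<open>le_part E v i\<close> and \<open>ge_part E v i\<close> are \<open>E_{v \<le> i}\<close> and \<open>E_{v \<ge> i}\<close>.
\<close>

definition le_part :: "('o, 'm) tcat \<Rightarrow> 'o set \<times> 'o set \<Rightarrow> int \<Rightarrow> 'o set" where
  "le_part E v i = shift E i ` fst v"

definition ge_part :: "('o, 'm) tcat \<Rightarrow> 'o set \<times> 'o set \<Rightarrow> int \<Rightarrow> 'o set" where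
  "ge_part E v i = shift E i ` snd v"

definition weight_structure :: "('o, 'm) tcat \<Rightarrow> 'o set \<times> 'o set \<Rightarrow> bool" where
  "weight_structure E v \<longleftrightarrow>
     retract_closed E (fst v) \<and> retract_closed E (snd v) \<and>
     fst v \<subseteq> le_part E v 1 \<and> ge_part E v 1 \<subseteq> snd v \<and>
     class_perp E (fst v) (ge_part E v 1) \<and>
     (\<forall>M \<in> Ob E. \<exists>L R f g h. Tri E L M R f g h \<and> L \<in> fst v \<and> R \<in> ge_part E v 1)"

definition left_degenerate :: "('o, 'm) tcat \<Rightarrow> 'o set \<times> 'o set \<Rightarrow> 'o \<Rightarrow> bool" where
  "left_degenerate E v X \<longleftrightarrow> (\<forall>i. X \<in> ge_part E v i)"

definition right_degenerate :: "('o, 'm) tcat \<Rightarrow> 'o set \<times> 'o set \<Rightarrow> 'o \<Rightarrow> bool" where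
  "right_degenerate E v X \<longleftrightarrow> (\<forall>i. X \<in> le_part E v i)"

definition essentially_positive :: "('o, 'm) tcat \<Rightarrow> 'o set \<times> 'o set \<Rightarrow> 'o \<Rightarrow> bool" where
  "essentially_positive E v M \<longleftrightarrow>
     (\<exists>S RD Y f g h. is_direct_sum E M (shift E 1 M) S \<and> Tri E RD S Y f g h \<and>
        Y \<in> snd v \<and> right_degenerate E v RD)"

definition essentially_negative :: "('o, 'm) tcat \<Rightarrow> 'o set \<times> 'o set \<Rightarrow> 'o \<Rightarrow> bool" where
  "essentially_negative E v M \<longleftrightarrow>
     (\<exists>S X LD f g h. is_direct_sum E M (shift E (- 1) M) S \<and> Tri E X S LD f g h \<and>
        X \<in> fst v \<and> left_degenerate E v LD)"

definition essentially_bounded_below :: "('o, 'm) tcat \<Rightarrow> 'o set \<times> 'o set \<Rightarrow> bool" where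
  "essentially_bounded_below E v \<longleftrightarrow>
     (\<forall>M \<in> Ob E. \<exists>n::int. essentially_positive E v (shift E (- n) M))"

definition essentially_bounded_above :: "('o, 'm) tcat \<Rightarrow> 'o set \<times> 'o set \<Rightarrow> bool" where
  "essentially_bounded_above E v \<longleftrightarrow>
     (\<forall>M \<in> Ob E. \<exists>n::int. essentially_negative E v (shift E (- n) M))"

definition coproductive_extension ::
  "'i set set \<Rightarrow> ('o, 'm) tcat \<Rightarrow> 'o set \<times> 'o set \<Rightarrow> 'o set \<times> 'o set \<Rightarrow> bool" where
  "coproductive_extension U C w0 w \<longleftrightarrow>
     weight_structure C w \<and>
     fst w = coproductive_hull U C (fst w0) \<and> snd w = coproductive_hull U C (snd w0)"

definition t_structure :: "('o, 'm) tcat \<Rightarrow> 'o set \<times> 'o set \<Rightarrow> bool" where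
  "t_structure E t \<longleftrightarrow>
     iso_closed E (fst t) \<and> iso_closed E (snd t) \<and>
     fst t \<subseteq> le_part E t 1 \<and> ge_part E t 1 \<subseteq> snd t \<and>
     class_perp E (ge_part E t 1) (fst t) \<and>
     (\<forall>M \<in> Ob E. \<exists>L R f g h. Tri E L M R f g h \<and> L \<in> snd t \<and> R \<in> le_part E t (- 1))"

definition heart :: "'o set \<times> 'o set \<Rightarrow> 'o set" where
  "heart t = fst t \<inter> snd t"

definition t_restriction :: "'o set \<times> 'o set \<Rightarrow> 'o set \<Rightarrow> 'o set \<times> 'o set" where
  "t_restriction t D = (fst t \<inter> D, snd t \<inter> D)"

definition t_restricts_to :: "('o, 'm) tcat \<Rightarrow> 'o set \<times> 'o set \<Rightarrow> 'o set \<Rightarrow> bool" where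
  "t_restricts_to E t D \<longleftrightarrow> t_structure (full_sub E D) (t_restriction t D)"

text \<open>
  In the next two definitions s is a t-structure on the full triangulated subcategory of C with
  object class D, while orthogonality is taken in C.
\<close>

definition orthogonal_to ::
  "('o, 'm) tcat \<Rightarrow> 'o set \<Rightarrow> 'o set \<times> 'o set \<Rightarrow> 'o set \<times> 'o set \<Rightarrow> bool" where
  "orthogonal_to C D s w0 \<longleftrightarrow>
     class_perp C (fst w0) (ge_part (full_sub C D) s 1) \<and>
     class_perp C (snd w0) (le_part (full_sub C D) s (- 1))"

definition strictly_orthogonal_to ::
  "('o, 'm) tcat \<Rightarrow> 'o set \<Rightarrow> 'o set \<times> 'o set \<Rightarrow> 'o set \<times> 'o set \<Rightarrow> bool" where
  "strictly_orthogonal_to C D s w0 \<longleftrightarrow>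
     ge_part (full_sub C D) s 1 = right_perp C (fst w0) \<inter> D \<and>
     le_part (full_sub C D) s (- 1) = right_perp C (snd w0) \<inter> D"

text \<open>
  Boundedness depends only on the values \<open>H X\<close> of a cohomological functor H on the objects X of E,
  and \<open>H\<^sup>i(X) = H(X[-i])\<close>. On objects, the functor represented by M is \<open>\<lambda>X. hom_group C X M\<close>.
\<close>

definition locally_bounded_below :: "('o, 'm) tcat \<Rightarrow> ('o \<Rightarrow> 'g monoid) \<Rightarrow> bool" where
  "locally_bounded_below E H \<longleftrightarrow>
     (\<forall>X \<in> Ob E. \<exists>n::int. \<forall>i<n. carrier (H (shift E (- i) X)) = {\<one>\<^bsub>H (shift E (- i) X)\<^esub>})"

definition locally_bounded_above :: "('o, 'm) tcat \<Rightarrow> ('o \<Rightarrow> 'g monoid) \<Rightarrow> bool" where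
  "locally_bounded_above E H \<longleftrightarrow>
     (\<forall>X \<in> Ob E. \<exists>n::int. \<forall>i>n. carrier (H (shift E (- i) X)) = {\<one>\<^bsub>H (shift E (- i) X)\<^esub>})"

definition plus_part :: "('o, 'm) tcat \<Rightarrow> 'o set \<Rightarrow> 'o set \<Rightarrow> 'o set" where
  "plus_part C C0 C' = {M \<in> C'. locally_bounded_below (full_sub C C0) (\<lambda>X. hom_group C X M)}"

definition minus_part :: "('o, 'm) tcat \<Rightarrow> 'o set \<Rightarrow> 'o set \<Rightarrow> 'o set" where
  "minus_part C C0 C' = {M \<in> C'. locally_bounded_above (full_sub C C0) (\<lambda>X. hom_group C X M)}"

definition bounded_part :: "('o, 'm) tcat \<Rightarrow> 'o set \<Rightarrow> 'o set \<Rightarrow> 'o set" where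
  "bounded_part C C0 C' =
     {M \<in> C'. locally_bounded_below (full_sub C C0) (\<lambda>X. hom_group C X M) \<and>
              locally_bounded_above (full_sub C C0) (\<lambda>X. hom_group C X M)}"

end

theory Submission
  imports Defs
begin

text \<open>
  Write \<open>L \<rightarrow> M \<rightarrow> R\<close> for the truncation triangle of an object M of \<open>C'\<close>, with \<open>L \<in> C'_{t \<ge> 0}\<close> and
  \<open>R \<in> C'_{t \<le> -1}\<close>. Two ideas carry the theorem.

  Strict orthogonality is a vanishing statement. An object Q that is right orthogonal to both
  \<open>C0_{w0 \<ge> 0}\<close> and \<open>C0_{w0 \<le> -1}\<close> is zero (\<open>weights_detect_zero\<close>): orthogonality passes to the
  coproductive hulls, and then both outer terms of a w-decomposition of \<open>Q[1]\<close> have no maps to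
  \<open>Q[1]\<close>, so \<open>C(Q[1], Q[1]) = 0\<close>. If M is orthogonal to one of the two halves of \<open>w0\<close>, then the
  term of its truncation triangle that ought to vanish is orthogonal to both halves, hence is
  zero, and M is isomorphic to the other term (\<open>perp_w0_imp_snd\<close>, \<open>perp_w0_imp_fst\<close>).

  The boundedness of \<open>w0\<close> ensures that truncation preserves the local boundedness of \<open>C(-, M)\<close> on
  \<open>C0\<close> (\<open>truncation_stable_at_bot\<close>, \<open>truncation_stable_at_top\<close>). Suppose that \<open>w0\<close> is essentially
  bounded below, and that \<open>C(X[j], M) = 0\<close> for \<open>j \<gg> 0\<close>, for every X in \<open>C0\<close>. Up to a shift, X is a
  retract of an extension of some \<open>Y \<in> C0_{w0 \<ge> 0}\<close> by a right degenerate object D. Here \<open>C(Y[j],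
  R) = 0\<close> for \<open>j \<ge> 0\<close> by orthogonality. All shifts of D lie in \<open>C0_{w0 \<le> 0}\<close>, so they have no maps
  to any shift of L; therefore \<open>C(D[j], R) = C(D[j], M)\<close>, which vanishes for \<open>j \<gg> 0\<close> because D is
  itself an object of \<open>C0\<close>. So R lies in the subcategory, and L with it. The bounded above case is
  dual, with left degenerate objects and the roles of L and R exchanged; the bounded case is the
  intersection of the two. The same test shows that the heart lies in the subcategory.

  The three subcategories are treated at once: vanishing for \<open>i \<ll> 0\<close>, for \<open>i \<gg> 0\<close> or for both is
  vanishing eventually along the filter \<open>at_bot\<close>, \<open>at_top\<close> or \<open>sup at_bot at_top\<close> on the integers.
\<close>

section \<open>Shifts\<close>

lemma shift_0 [simp]: "shift E 0 X = X"
  by (simp add: shift_def)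

lemma shift_1: "shift E 1 X = Sh E X"
  by (simp add: shift_def)

context
  fixes E :: "('o, 'm) tcat"
  assumes bij: "bij_betw (Sh E) (Ob E) (Ob E)"
begin

lemma Sh_in_Ob: "X \<in> Ob E \<Longrightarrow> Sh E X \<in> Ob E"
  using bij bij_betwE by blast

lemma inv_Sh_in_Ob: "X \<in> Ob E \<Longrightarrow> inv_into (Ob E) (Sh E) X \<in> Ob E"
  by (metis bij bij_betw_imp_surj_on inv_into_into)

lemma shift_in_Ob:
  assumes "X \<in> Ob E"
  shows "shift E i X \<in> Ob E"
proof -
  have "(Sh E ^^ n) X \<in> Ob E" and "(inv_into (Ob E) (Sh E) ^^ n) X \<in> Ob E" for n
    by (induction n) (auto simp: assms Sh_in_Ob inv_Sh_in_Ob)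
  then show ?thesis
    by (simp add: shift_def)
qed

lemma shift_Suc:
  assumes "X \<in> Ob E"
  shows "shift E (i + 1) X = Sh E (shift E i X)"
proof (cases "0 \<le> i")
  case True
  then show ?thesis
    by (simp add: shift_def nat_add_distrib)
next
  case False
  define n where "n = nat (- (i + 1))"
  have i: "i + 1 = - int n" "nat (- i) = Suc n"
    using False by (auto simp: n_def)
  have eq: "shift E (- int n) X = (inv_into (Ob E) (Sh E) ^^ n) X"
    by (cases "n = 0") (auto simp: shift_def)
  have "Sh E (inv_into (Ob E) (Sh E) (shift E (- int n) X)) = shift E (- int n) X"
    by (meson assms bij bij_betw_inv_into_right shift_in_Ob)
  then show ?thesis
    using False i eq by (simp add: shift_def)
qed

lemma shift_shift:
  assumes "X \<in> Ob E"
  shows "shift E i (shift E j X) = shift E (i + j) X"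
proof (induction i rule: int_induct[where k = 0])
  case base
  show ?case by simp
next
  case (step1 i)
  then show ?case
    using shift_Suc[of "shift E j X" i] shift_Suc[of X "i + j"] assms
    by (simp add: shift_in_Ob algebra_simps)
next
  case (step2 i)
  have "Sh E (shift E (i - 1) (shift E j X)) = Sh E (shift E (i - 1 + j) X)"
    using step2 shift_Suc[of "shift E j X" "i - 1"] shift_Suc[of X "i - 1 + j"] assms
    by (simp add: shift_in_Ob algebra_simps)
  then show ?case
    by (metis assms bij bij_betw_inv_into_left shift_in_Ob)
qed

end

text \<open>
  The property of \<open>D\<close> under which the shift of \<open>full_sub C D\<close>, whose negative powers invert the
  translation only on \<open>D\<close>, agrees with that of \<open>C\<close>.
\<close>

definition shift_stable :: "('o, 'm) tcat \<Rightarrow> 'o set \<Rightarrow> bool" where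
  "shift_stable C D \<longleftrightarrow> D \<subseteq> Ob C \<and> (\<forall>X \<in> Ob C. Sh C X \<in> D \<longleftrightarrow> X \<in> D)"

lemma triangulated_subcategory_shift_stable:
  "triangulated_subcategory C D \<Longrightarrow> shift_stable C D"
  unfolding triangulated_subcategory_def shift_stable_def iso_closed_def
  by (elim conjE) (intro conjI)

lemma shift_stable_Sh_bij:
  assumes b: "bij_betw (Sh C) (Ob C) (Ob C)" and D: "shift_stable C D"
  shows "bij_betw (Sh C) D D"
proof -
  have "inj_on (Sh C) D"
    using b D by (auto simp: shift_stable_def bij_betw_def intro: inj_on_subset)
  moreover have "Sh C ` D = D"
  proof (intro equalityI subsetI)
    fix Y assume Y: "Y \<in> D"
    then have "Y \<in> Sh C ` Ob C"
      using b D by (auto simp: shift_stable_def bij_betw_def)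
    then obtain X where "X \<in> Ob C" "Y = Sh C X"
      by blast
    then show "Y \<in> Sh C ` D"
      using Y D by (auto simp: shift_stable_def)
  qed (use D in \<open>auto simp: shift_stable_def\<close>)
  ultimately show ?thesis
    by (simp add: bij_betw_def)
qed

lemma full_sub_simps:
  "Ob (full_sub C D) = D" "Hom (full_sub C D) = Hom C" "Comp (full_sub C D) = Comp C"
  "Id (full_sub C D) = Id C" "Add (full_sub C D) = Add C" "Zero (full_sub C D) = Zero C"
  "Sh (full_sub C D) = Sh C"
  "Tri (full_sub C D) X Y Z f g h \<longleftrightarrow> X \<in> D \<and> Y \<in> D \<and> Z \<in> D \<and> Tri C X Y Z f g h"
  by (simp_all add: full_sub_def)

lemma full_sub_full_sub:
  assumes "D \<subseteq> E"
  shows "full_sub (full_sub C E) D = full_sub C D"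
proof -
  have "(X \<in> D \<and> Y \<in> D \<and> Z \<in> D \<and> X \<in> E \<and> Y \<in> E \<and> Z \<in> E \<and> T) \<longleftrightarrow>
      (X \<in> D \<and> Y \<in> D \<and> Z \<in> D \<and> T)" for X Y Z T
    using assms by blast
  then show ?thesis
    by (simp add: full_sub_def)
qed

lemma isomorphic_full_sub: "isomorphic (full_sub C D) = isomorphic C"
  by (intro ext) (simp add: isomorphic_def is_iso_def iso_pair_def full_sub_simps)

lemma direct_summand_retract:
  assumes "is_direct_sum (full_sub C D) A B S"
  shows "retract_of C A S"
proof -
  obtain i1 i2 p1 p2 where "biproduct (full_sub C D) A B S i1 i2 p1 p2"
    using assms by (auto simp: is_direct_sum_def)
  then have "i1 \<in> Hom C A S" "p1 \<in> Hom C S A" "Comp C p1 i1 = Id C A"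
    by (simp_all add: biproduct_def full_sub_simps)
  then show ?thesis
    by (auto simp: retract_of_def)
qed

lemma shift_full_sub:
  assumes b: "bij_betw (Sh C) (Ob C) (Ob C)" and D: "shift_stable C D" and X: "X \<in> D"
  shows "shift (full_sub C D) i X = shift C i X"
proof -
  let ?E = "full_sub C D"
  have D': "X \<in> Ob C" if "X \<in> D" for X
    using D that by (auto simp: shift_stable_def)
  have b': "bij_betw (Sh ?E) (Ob ?E) (Ob ?E)"
    using shift_stable_Sh_bij[OF b D] by (simp add: full_sub_simps)
  show ?thesis
  proof (induction i rule: int_induct[where k = 0])
    case base
    show ?case
      by (simp add: shift_def)
  next
    case (step1 i)
    then show ?case
      using shift_Suc[OF b' , of X i] shift_Suc[OF b, of X i] X D'
      by (simp add: full_sub_simps)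
  next
    case (step2 i)
    have mem: "shift ?E (i - 1) X \<in> D"
      using shift_in_Ob[OF b', of X "i - 1"] X by (simp add: full_sub_simps)
    have "Sh C (shift ?E (i - 1) X) = Sh C (shift C (i - 1) X)"
      using shift_Suc[OF b' , of X "i - 1"] shift_Suc[OF b, of X "i - 1"] X D' step2
      by (simp add: full_sub_simps)
    then show ?case
      using b mem X D' by (metis bij_betw_inv_into_left shift_in_Ob)
  qed
qed

lemma shift_mem_shift_stable:
  assumes b: "bij_betw (Sh C) (Ob C) (Ob C)" and D: "shift_stable C D" and X: "X \<in> Ob C"
  shows "shift C i X \<in> D \<longleftrightarrow> X \<in> D"
proof -
  have mem: "shift C i X \<in> D" if "X \<in> D" for X i
  proof -
    have "shift (full_sub C D) i X \<in> Ob (full_sub C D)"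
      by (rule shift_in_Ob)
        (use shift_stable_Sh_bij[OF b D] that in \<open>simp_all add: full_sub_simps\<close>)
    then show ?thesis
      using shift_full_sub[OF b D that] by (simp add: full_sub_simps)
  qed
  show ?thesis
    using mem[of "shift C i X" "- i"] mem[of X i] shift_shift[OF b X, of "- i" i]
    by auto
qed

text \<open>
  This makes \<open>E_{v \<le> i}\<close> and \<open>E_{v \<ge> i}\<close> independent of the ambient subcategory \<open>E\<close>, so that the
  same description serves \<open>C0\<close>, \<open>C'\<close>, \<open>C\<close> and the subcategories of bounded objects.
\<close>

lemma shift_image_full_sub:
  assumes b: "bij_betw (Sh C) (Ob C) (Ob C)" and D: "shift_stable C D" and P: "P \<subseteq> D"
  shows "shift (full_sub C D) i ` P = {X \<in> Ob C. shift C (- i) X \<in> P}"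
proof -
  have D': "X \<in> Ob C" if "X \<in> P" for X
    using D P that by (auto simp: shift_stable_def)
  have "shift (full_sub C D) i ` P = shift C i ` P"
    by (rule image_cong) (use P shift_full_sub[OF b D] in auto)
  also have "\<dots> = {X \<in> Ob C. shift C (- i) X \<in> P}"
  proof (intro equalityI subsetI)
    fix X assume "X \<in> shift C i ` P"
    then show "X \<in> {X \<in> Ob C. shift C (- i) X \<in> P}"
      using D' shift_shift[OF b] shift_in_Ob[OF b] by auto
  next
    fix X assume X: "X \<in> {X \<in> Ob C. shift C (- i) X \<in> P}"
    then have "X = shift C i (shift C (- i) X)"
      using shift_shift[OF b, of X i "- i"] by simp
    then show "X \<in> shift C i ` P"
      using X by blast
  qed
  finally show ?thesis .
qed

section \<open>Exactness of Hom\<close>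

lemma isomorphic_imp_retract: "isomorphic C X Y \<Longrightarrow> retract_of C X Y"
  by (auto simp: isomorphic_def is_iso_def iso_pair_def retract_of_def)

context additive_category
begin

lemma Zero_Hom: "\<lbrakk>X \<in> Ob C; Y \<in> Ob C\<rbrakk> \<Longrightarrow> Zero C X Y \<in> Hom C X Y"
  using monoid.one_closed[of "hom_group C X Y"] hom_group[of X Y]
  by (auto simp: comm_group_def group_def hom_group_def)

text \<open>
  Used to show that additive maps preserve zero morphisms: the image of zero is idempotent.
\<close>

lemma Add_idem_imp_Zero:
  assumes "X \<in> Ob C" "Y \<in> Ob C" "f \<in> Hom C X Y" "Add C f f = f"
  shows "f = Zero C X Y"
proof -
  interpret G: comm_group "hom_group C X Y"
    by (rule hom_group) fact+
  show ?thesis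
    using G.l_cancel_one[of f f] assms by (simp add: hom_group_def)
qed

lemma Add_Zero: "\<lbrakk>X \<in> Ob C; Y \<in> Ob C; f \<in> Hom C X Y\<rbrakk> \<Longrightarrow> Add C (Zero C X Y) f = f"
  using monoid.l_one[of "hom_group C X Y" f] hom_group[of X Y]
  by (auto simp: comm_group_def group_def hom_group_def)

lemma Comp_Zero_right:
  assumes "X \<in> Ob C" "Y \<in> Ob C" "Z \<in> Ob C" "g \<in> Hom C Y Z"
  shows "Comp C g (Zero C X Y) = Zero C X Z"
  using assms Comp_Add_right[of X Y Z "Zero C X Y" "Zero C X Y" g] Comp_Hom[of X Y Z _ g]
  by (intro Add_idem_imp_Zero) (simp_all add: Add_Zero Zero_Hom)

lemma Comp_Zero_left:
  assumes "X \<in> Ob C" "Y \<in> Ob C" "Z \<in> Ob C" "f \<in> Hom C X Y"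
  shows "Comp C (Zero C Y Z) f = Zero C X Z"
  using assms Comp_Add_left[of X Y Z f "Zero C Y Z" "Zero C Y Z"] Comp_Hom[of X Y Z f]
  by (intro Add_idem_imp_Zero) (simp_all add: Add_Zero Zero_Hom)

abbreviation neg where
  "neg X Y f \<equiv> inv\<^bsub>hom_group C X Y\<^esub> f"

lemma neg_Hom: "\<lbrakk>X \<in> Ob C; Y \<in> Ob C; f \<in> Hom C X Y\<rbrakk> \<Longrightarrow> neg X Y f \<in> Hom C X Y"
  using group.inv_closed[of "hom_group C X Y" f] hom_group[of X Y]
  by (auto simp: comm_group_def hom_group_def)

lemma neg_Zero: "\<lbrakk>X \<in> Ob C; Y \<in> Ob C\<rbrakk> \<Longrightarrow> neg X Y (Zero C X Y) = Zero C X Y"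
  using hom_group[of X Y] monoid.inv_one[of "hom_group C X Y"]
  by (auto simp: comm_group_def hom_group_def group_def)

lemma Add_neg:
  "\<lbrakk>X \<in> Ob C; Y \<in> Ob C; f \<in> Hom C X Y\<rbrakk> \<Longrightarrow> Add C f (neg X Y f) = Zero C X Y"
  using group.r_inv[of "hom_group C X Y" f] hom_group[of X Y]
  by (auto simp: comm_group_def hom_group_def)

lemma neg_unique:
  assumes "X \<in> Ob C" "Y \<in> Ob C" "f \<in> Hom C X Y" "g \<in> Hom C X Y" "Add C f g = Zero C X Y"
  shows "g = neg X Y f"
proof -
  interpret G: comm_group "hom_group C X Y"
    by (rule hom_group) fact+
  show ?thesis
    using G.inv_equality[of g f] assms G.m_comm[of f g] by (simp add: hom_group_def)
qed

lemma neg_inject: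
  assumes "X \<in> Ob C" "Y \<in> Ob C" "f \<in> Hom C X Y" "g \<in> Hom C X Y" "neg X Y f = neg X Y g"
  shows "f = g"
proof -
  interpret G: comm_group "hom_group C X Y"
    by (rule hom_group) fact+
  show ?thesis
    using assms G.inv_inv[of f] G.inv_inv[of g] by (simp add: hom_group_def)
qed

lemma Comp_neg_left:
  assumes "X \<in> Ob C" "Y \<in> Ob C" "Z \<in> Ob C" "f \<in> Hom C X Y" "g \<in> Hom C Y Z"
  shows "Comp C (neg Y Z g) f = neg X Z (Comp C g f)"
  using assms Comp_Add_left[of X Y Z f g "neg Y Z g"] Comp_Hom[of X Y Z f]
  by (intro neg_unique) (simp_all add: Add_neg neg_Hom Comp_Zero_left)

lemma Comp_neg_right:
  assumes "X \<in> Ob C" "Y \<in> Ob C" "Z \<in> Ob C" "f \<in> Hom C X Y" "g \<in> Hom C Y Z"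
  shows "Comp C g (neg X Y f) = neg X Z (Comp C g f)"
  using assms Comp_Add_right[of X Y Z f "neg X Y f" g] Comp_Hom[of X Y Z _ g]
  by (intro neg_unique) (simp_all add: Add_neg neg_Hom Comp_Zero_right)

lemma perpI: "\<lbrakk>X \<in> Ob C; Y \<in> Ob C; \<And>f. f \<in> Hom C X Y \<Longrightarrow> f = Zero C X Y\<rbrakk> \<Longrightarrow> perp C X Y"
  using Zero_Hom by (auto simp: perp_def)

lemma perpD: "\<lbrakk>perp C X Y; f \<in> Hom C X Y\<rbrakk> \<Longrightarrow> f = Zero C X Y"
  by (auto simp: perp_def)

text \<open>
  \<open>perp C Q Q\<close> says that the identity of \<open>Q\<close> is zero, and is used below as the working form of
  "Q is a zero object".
\<close>

lemma zero_perp_left: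
  assumes "perp C Q Q" "Q \<in> Ob C" "X \<in> Ob C"
  shows "perp C Q X"
  by (rule perpI) (use assms perpD[OF assms(1) Id_Hom] in \<open>metis Comp_Id_right Comp_Zero_right\<close>)+

lemma zero_perp_right:
  assumes "perp C Q Q" "Q \<in> Ob C" "X \<in> Ob C"
  shows "perp C X Q"
  by (rule perpI) (use assms perpD[OF assms(1) Id_Hom] in \<open>metis Comp_Id_left Comp_Zero_left\<close>)+

lemma zero_object_iff_perp:
  "zero_object C Z \<longleftrightarrow> Z \<in> Ob C \<and> perp C Z Z"
proof
  assume "zero_object C Z"
  then show "Z \<in> Ob C \<and> perp C Z Z"
    by (metis perpI Zero_Hom zero_object_def)
next
  assume Z: "Z \<in> Ob C \<and> perp C Z Z"
  have "\<exists>!f. f \<in> Hom C X Z" and "\<exists>!f. f \<in> Hom C Z X" if "X \<in> Ob C" for X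
    using zero_perp_left[of Z X] zero_perp_right[of Z X] Z that by (auto simp: perp_def)
  then show "zero_object C Z"
    using Z by (simp add: zero_object_def)
qed

lemma perp_retract_right:
  assumes "perp C W Y" "retract_of C X Y" "W \<in> Ob C" "X \<in> Ob C" "Y \<in> Ob C"
  shows "perp C W X"
proof (rule perpI)
  fix f assume f: "f \<in> Hom C W X"
  obtain i p where ip: "i \<in> Hom C X Y" "p \<in> Hom C Y X" "Comp C p i = Id C X"
    using assms by (auto simp: retract_of_def)
  have "f = Comp C p (Comp C i f)"
    using Comp_assoc[of W X Y X f i p] assms f ip by (simp add: Comp_Id_left)
  also have "Comp C i f = Zero C W Y"
    using assms f ip Comp_Hom[of W X Y f i] by (intro perpD)
  finally show "f = Zero C W X"
    using assms ip by (simp add: Comp_Zero_right)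
qed fact+

lemma perp_retract_left:
  assumes "perp C Y W" "retract_of C X Y" "W \<in> Ob C" "X \<in> Ob C" "Y \<in> Ob C"
  shows "perp C X W"
proof (rule perpI)
  fix f assume f: "f \<in> Hom C X W"
  obtain i p where ip: "i \<in> Hom C X Y" "p \<in> Hom C Y X" "Comp C p i = Id C X"
    using assms by (auto simp: retract_of_def)
  have "f = Comp C (Comp C f p) i"
    using Comp_assoc[of X Y X W i p f] assms f ip by (simp add: Comp_Id_right)
  also have "Comp C f p = Zero C Y W"
    using assms f ip Comp_Hom[of Y X W p f] by (intro perpD)
  finally show "f = Zero C X W"
    using assms ip by (simp add: Comp_Zero_left)
qed fact+

end

context triangulated_category
begin

lemma Sh_Ob: "X \<in> Ob C \<Longrightarrow> Sh C X \<in> Ob C"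
  by (rule Sh_in_Ob[OF Sh_bij])

lemma shift_Ob: "X \<in> Ob C \<Longrightarrow> shift C i X \<in> Ob C"
  by (rule shift_in_Ob[OF Sh_bij])

lemma shift_add: "X \<in> Ob C \<Longrightarrow> shift C i (shift C j X) = shift C (i + j) X"
  by (rule shift_shift[OF Sh_bij])

lemma ShM_Hom: "\<lbrakk>X \<in> Ob C; Y \<in> Ob C; f \<in> Hom C X Y\<rbrakk> \<Longrightarrow> ShM C f \<in> Hom C (Sh C X) (Sh C Y)"
  using ShM_bij bij_betwE by blast

lemma ShM_inject:
  "\<lbrakk>X \<in> Ob C; Y \<in> Ob C; f \<in> Hom C X Y; g \<in> Hom C X Y; ShM C f = ShM C g\<rbrakk> \<Longrightarrow> f = g"
  using ShM_bij[of X Y] by (auto simp: bij_betw_def inj_on_def)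

lemma ShM_surj:
  "\<lbrakk>X \<in> Ob C; Y \<in> Ob C; g \<in> Hom C (Sh C X) (Sh C Y)\<rbrakk> \<Longrightarrow> \<exists>f \<in> Hom C X Y. ShM C f = g"
  using ShM_bij[of X Y] by (force simp: bij_betw_def)

lemma ShM_Zero: "\<lbrakk>X \<in> Ob C; Y \<in> Ob C\<rbrakk> \<Longrightarrow> ShM C (Zero C X Y) = Zero C (Sh C X) (Sh C Y)"
  using ShM_Add[of X Y "Zero C X Y" "Zero C X Y"]
  by (intro Add_idem_imp_Zero) (simp_all add: Add_Zero Zero_Hom Sh_Ob ShM_Hom)

lemma perp_Sh:
  assumes "X \<in> Ob C" "Y \<in> Ob C"
  shows "perp C (Sh C X) (Sh C Y) \<longleftrightarrow> perp C X Y"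
proof
  assume "perp C (Sh C X) (Sh C Y)"
  then show "perp C X Y"
    using assms by (intro perpI) (metis ShM_Hom ShM_Zero ShM_inject Zero_Hom perpD)+
next
  assume "perp C X Y"
  then show "perp C (Sh C X) (Sh C Y)"
    using assms by (intro perpI) (metis Sh_Ob ShM_Zero ShM_surj perpD)+
qed

lemma perp_shift_shift:
  assumes "X \<in> Ob C" "Y \<in> Ob C"
  shows "perp C (shift C i X) (shift C i Y) \<longleftrightarrow> perp C X Y"
proof (induction i rule: int_induct[where k = 0])
  case base
  show ?case by simp
next
  case (step1 i)
  then show ?case
    using assms by (simp add: shift_Suc[OF Sh_bij] perp_Sh shift_Ob)
next
  case (step2 i)
  then show ?case
    using assms shift_Suc[OF Sh_bij, of _ "i - 1"] by (simp add: perp_Sh shift_Ob)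
qed

lemma perp_shift_left:
  assumes "X \<in> Ob C" "Y \<in> Ob C"
  shows "perp C (shift C i X) Y \<longleftrightarrow> perp C X (shift C (- i) Y)"
  using perp_shift_shift[of "shift C i X" Y "- i"] assms by (simp add: shift_Ob shift_add)

lemma isomorphic_Sh_imp:
  assumes "X \<in> Ob C" "Y \<in> Ob C" "isomorphic C (Sh C X) (Sh C Y)"
  shows "isomorphic C X Y"
proof -
  obtain f g where fg: "f \<in> Hom C (Sh C X) (Sh C Y)" "g \<in> Hom C (Sh C Y) (Sh C X)"
      "Comp C g f = Id C (Sh C X)" "Comp C f g = Id C (Sh C Y)"
    using assms by (auto simp: isomorphic_def is_iso_def iso_pair_def)
  then obtain f' g' where f': "f' \<in> Hom C X Y" "ShM C f' = f" and g': "g' \<in> Hom C Y X" "ShM C g' = g"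
    using assms ShM_surj by metis
  have "Comp C g' f' = Id C X"
    using fg f' g' assms ShM_Comp[of X Y X f' g'] ShM_inject[of X X "Comp C g' f'" "Id C X"]
    by (simp add: ShM_Id Id_Hom Comp_Hom)
  moreover have "Comp C f' g' = Id C Y"
    using fg f' g' assms ShM_Comp[of Y X Y g' f'] ShM_inject[of Y Y "Comp C f' g'" "Id C Y"]
    by (simp add: ShM_Id Id_Hom Comp_Hom)
  ultimately show ?thesis
    using f' g' by (auto simp: isomorphic_def is_iso_def iso_pair_def)
qed

lemma isomorphic_Sh:
  assumes "X \<in> Ob C" "Y \<in> Ob C" "isomorphic C X Y"
  shows "isomorphic C (Sh C X) (Sh C Y)"
proof -
  obtain f g where "iso_pair C X Y f g"
    using assms by (auto simp: isomorphic_def is_iso_def)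
  then have "iso_pair C (Sh C X) (Sh C Y) (ShM C f) (ShM C g)"
    using assms ShM_Comp[of X Y X f g] ShM_Comp[of Y X Y g f]
    by (simp add: iso_pair_def ShM_Hom ShM_Id)
  then show ?thesis
    by (auto simp: isomorphic_def is_iso_def)
qed

lemma Tri_rotate:
  "Tri C X Y Z f g h \<Longrightarrow> Tri C Y Z (Sh C X) g h (neg (Sh C X) (Sh C Y) (ShM C f))"
  using TR2 Tri_typed by meson

lemma zero_object_Sh: "zero_object C Z \<Longrightarrow> zero_object C (Sh C Z)"
  by (simp add: zero_object_iff_perp perp_Sh Sh_Ob)

text \<open>
  Exactness of \<open>C(W, -)\<close> at the middle term. The pair formed by \<open>u\<close> and zero is a map
  from the rotation of the triangle \<open>W = W \<rightarrow> 0\<close> to the rotation of the given one. Its completion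
  \<open>W[1] \<rightarrow> X[1]\<close> desuspends to the required factor; the signs of the two rotations cancel.
\<close>

lemma factor_through_first:
  assumes T: "Tri C X Y Z f g h" and W: "W \<in> Ob C" and u: "u \<in> Hom C W Y"
    and gu: "Comp C g u = Zero C W Z"
  shows "\<exists>v \<in> Hom C W X. Comp C f v = u"
proof -
  note ty = Tri_typed[OF T]
  obtain O0 where O0: "zero_object C O0"
    using ex_zero_object by blast
  then have O0': "O0 \<in> Ob C"
    by (simp add: zero_object_def)
  let ?f = "ShM C f"
  have T0: "Tri C W O0 (Sh C W) (Zero C W O0) (Zero C O0 (Sh C W))
      (neg (Sh C W) (Sh C W) (ShM C (Id C W)))"
    using Tri_rotate[OF TR1_Id[OF W O0]] .
  have "Comp C (Zero C O0 Z) (Zero C W O0) = Comp C g u"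
    using gu W O0' ty by (simp add: Comp_Zero_right Zero_Hom)
  then obtain c where c: "c \<in> Hom C (Sh C W) (Sh C X)"
      and eq: "Comp C (ShM C u) (neg (Sh C W) (Sh C W) (ShM C (Id C W)))
        = Comp C (neg (Sh C X) (Sh C Y) ?f) c"
    using TR3[OF T0 Tri_rotate[OF T] u, of "Zero C O0 Z"] O0' ty by (auto simp: Zero_Hom)
  obtain v where v: "v \<in> Hom C W X" "ShM C v = c"
    using ShM_surj c W ty by blast
  have "neg (Sh C W) (Sh C Y) (ShM C u) = neg (Sh C W) (Sh C Y) (Comp C ?f c)"
    using eq ty W u c ShM_Hom[of W Y u] ShM_Hom[of X Y f]
      Comp_neg_left[of "Sh C W" "Sh C X" "Sh C Y" c ?f]
      Comp_neg_right[of "Sh C W" "Sh C W" "Sh C Y" "Id C (Sh C W)" "ShM C u"]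
      Comp_Id_right[of "Sh C W" "Sh C Y" "ShM C u"]
    by (simp add: Sh_Ob Id_Hom ShM_Id)
  then have "ShM C u = Comp C ?f c"
    using ty W u c ShM_Hom[of X Y f] Comp_Hom[of "Sh C W" "Sh C X" "Sh C Y" c ?f]
    by (rule_tac neg_inject[of "Sh C W" "Sh C Y"]) (simp_all add: ShM_Hom Sh_Ob)
  also have "\<dots> = ShM C (Comp C f v)"
    using v W ty ShM_Comp[of W X Y v f] by simp
  finally have "u = Comp C f v"
    using W u v ty Comp_Hom[of W X Y v f] by (rule_tac ShM_inject[of W Y]) simp_all
  then show ?thesis
    using v by blast
qed

text \<open>
  Exactness of \<open>C(-, W)\<close>: complete the map given by zero and \<open>u\<close> to the triangle \<open>0 \<rightarrow> W = W\<close>,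
  which comes from the identity triangle by rotating backwards.
\<close>

lemma factor_through_third:
  assumes T: "Tri C X Y Z f g h" and W: "W \<in> Ob C" and u: "u \<in> Hom C Y W"
    and uf: "Comp C u f = Zero C X W"
  shows "\<exists>v \<in> Hom C Z W. Comp C v g = u"
proof -
  note ty = Tri_typed[OF T]
  obtain O0 where O0: "zero_object C O0"
    using ex_zero_object by blast
  then have O0': "O0 \<in> Ob C"
    by (simp add: zero_object_def)
  have "Tri C W W (Sh C O0) (Id C W) (Zero C W (Sh C O0))
      (neg (Sh C O0) (Sh C W) (ShM C (Zero C O0 W)))"
    using TR1_Id[OF W zero_object_Sh[OF O0]] O0' W by (simp add: ShM_Zero neg_Zero Sh_Ob)
  then have T0: "Tri C O0 W W (Zero C O0 W) (Id C W) (Zero C W (Sh C O0))"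
    using TR2[of O0 W W "Zero C O0 W" "Id C W" "Zero C W (Sh C O0)"] O0' W
    by (simp add: Zero_Hom Id_Hom Sh_Ob)
  have "Comp C u f = Comp C (Zero C O0 W) (Zero C X O0)"
    using uf W O0' ty by (simp add: Comp_Zero_right Zero_Hom)
  then obtain v where "v \<in> Hom C Z W" "Comp C v g = Comp C (Id C W) u"
    using TR3[OF T T0 _ u, of "Zero C X O0"] O0' ty by (auto simp: Zero_Hom)
  then show ?thesis
    using W u ty by (auto simp: Comp_Id_left)
qed

lemma perp_middle_right:
  assumes T: "Tri C X Y Z f g h" and W: "W \<in> Ob C" and "perp C W X" "perp C W Z"
  shows "perp C W Y"
proof (rule perpI)
  note ty = Tri_typed[OF T]
  fix u assume u: "u \<in> Hom C W Y"
  have "Comp C g u = Zero C W Z"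
    using assms u ty Comp_Hom[of W Y Z u g] by (simp add: perpD)
  then obtain v where "v \<in> Hom C W X" "Comp C f v = u"
    using factor_through_first[OF T W u] by blast
  then show "u = Zero C W Y"
    using assms ty perpD[of W X v] Comp_Zero_right[of W X Y f] by auto
qed (use Tri_typed[OF T] W in auto)

lemma perp_middle_left:
  assumes T: "Tri C X Y Z f g h" and W: "W \<in> Ob C" and "perp C X W" "perp C Z W"
  shows "perp C Y W"
proof (rule perpI)
  note ty = Tri_typed[OF T]
  fix u assume u: "u \<in> Hom C Y W"
  have "Comp C u f = Zero C X W"
    using assms u ty Comp_Hom[of X Y W f u] by (simp add: perpD)
  then obtain v where "v \<in> Hom C Z W" "Comp C v g = u"
    using factor_through_third[OF T W u] by blast
  then show "u = Zero C Y W"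
    using assms ty perpD[of Z W v] Comp_Zero_left[of Y Z W g] by auto
qed (use Tri_typed[OF T] W in auto)

text \<open>
  The long exact sequence, restricted to vanishing. Shifts are put on the test object \<open>W\<close>,
  so only rotations of the given triangle occur, never its shifts.
\<close>

lemma perp_cone:
  assumes T: "Tri C X Y Z f g h" and W: "W \<in> Ob C"
    and "perp C W Y" "perp C (shift C (- 1) W) X"
  shows "perp C W Z"
  using perp_middle_right[OF Tri_rotate[OF T] W] assms Tri_typed[OF T]
  by (simp add: perp_shift_left shift_1)

lemma perp_fibre:
  assumes T: "Tri C X Y Z f g h" and W: "W \<in> Ob C"
    and "perp C W Y" "perp C (shift C 1 W) Z"
  shows "perp C W X"
  using perp_middle_right[OF Tri_rotate[OF Tri_rotate[OF T]] Sh_Ob[OF W]] assms Tri_typed[OF T]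
  by (simp add: perp_Sh shift_1)

text \<open>
  As \<open>X\<close> and \<open>X[1]\<close> vanish, the identities of \<open>Y\<close> and \<open>Z\<close> factor through \<open>g\<close>, which yields a left
  and a right inverse.
\<close>

lemma Tri_zero_first_imp_iso:
  assumes T: "Tri C X Y Z f g h" and X: "perp C X X"
  shows "is_iso C Y Z g"
proof -
  note ty = Tri_typed[OF T]
  have "Comp C (Id C Y) f = Zero C X Y"
    using X ty zero_perp_left[of X Y] Comp_Id_left[of X Y f] perpD[of X Y f] by simp
  then obtain r where r: "r \<in> Hom C Z Y" "Comp C r g = Id C Y"
    using factor_through_third[OF T, of Y "Id C Y"] ty by (auto simp: Id_Hom)
  have "perp C Z (Sh C X)"
    using X ty zero_perp_right[of "Sh C X" Z] by (simp add: perp_Sh Sh_Ob)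
  then have "Comp C h (Id C Z) = Zero C Z (Sh C X)"
    using ty Comp_Id_right[of Z "Sh C X" h] perpD[of Z "Sh C X" h] by (simp add: Sh_Ob)
  then obtain s where s: "s \<in> Hom C Z Y" "Comp C g s = Id C Z"
    using factor_through_first[OF Tri_rotate[OF T], of Z "Id C Z"] ty by (auto simp: Id_Hom)
  have "r = Comp C r (Comp C g s)"
    using r s ty Comp_Id_right[of Z Y r] by simp
  also have "\<dots> = s"
    using r s ty Comp_assoc[of Z Y Z Y s g r] Comp_Id_left[of Z Y s] by simp
  finally show ?thesis
    using r s ty by (auto simp: is_iso_def iso_pair_def)
qed

lemma Tri_zero_first_imp_isomorphic:
  "\<lbrakk>Tri C X Y Z f g h; perp C X X\<rbrakk> \<Longrightarrow> isomorphic C Y Z"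
  unfolding isomorphic_def using Tri_zero_first_imp_iso by blast

lemma Tri_zero_third_imp_isomorphic:
  assumes T: "Tri C X Y Z f g h" and Z: "perp C Z Z"
  shows "isomorphic C X Y"
  using Tri_zero_first_imp_isomorphic[OF Tri_rotate[OF Tri_rotate[OF T]] Z] Tri_typed[OF T]
    isomorphic_Sh_imp[of X Y] by blast

lemma isomorphic_sym: "isomorphic C X Y \<Longrightarrow> isomorphic C Y X"
  by (auto simp: isomorphic_def is_iso_def iso_pair_def)

section \<open>Orthogonality and coproductive hulls\<close>

text \<open>
  The class of all objects without maps to \<open>Y\<close> has every closure property of the hull: a map out of
  a coproduct is determined by its components, and extensions are handled by exactness.
\<close>

lemma coproductive_hull_perp:
  assumes Y: "Y \<in> Ob C" and G: "G \<subseteq> Ob C" "\<And>X. X \<in> G \<Longrightarrow> perp C X Y"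
    and X: "X \<in> coproductive_hull U C G"
  shows "perp C X Y"
proof -
  define P where "P = {X \<in> Ob C. perp C X Y}"
  have "retract_closed C P"
    using Y by (auto simp: retract_closed_def P_def intro: perp_retract_left)
  moreover have "extension_closed C P"
    using Y Tri_typed
    by (auto simp: extension_closed_def P_def zero_object_iff_perp
        intro: zero_perp_left perp_middle_left)
  moreover have "coproduct_closed U C P"
    unfolding coproduct_closed_def
  proof (intro ballI allI impI, elim conjE)
    fix I X S j assume X: "\<forall>i\<in>I. X i \<in> P" and S: "coproduct C I X S j"
    have S': "S \<in> Ob C" and j: "\<And>i. i \<in> I \<Longrightarrow> X i \<in> Ob C \<and> j i \<in> Hom C (X i) S"
      using S by (auto simp: coproduct_def)
    have "perp C S Y"
    proof (rule perpI[OF S' Y])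
      fix g assume g: "g \<in> Hom C S Y"
      have zero: "Comp C k (j i) = Zero C (X i) Y" if "i \<in> I" "k \<in> Hom C S Y" for i k
        using X j that S' Y Comp_Hom[of "X i" S Y "j i" k] by (auto simp: P_def perp_def)
      have "\<exists>!g. g \<in> Hom C S Y \<and> (\<forall>i\<in>I. Comp C g (j i) = Zero C (X i) Y)"
        using S Y j by (auto simp: coproduct_def Zero_Hom)
      then show "g = Zero C S Y"
        using g zero Zero_Hom[OF S' Y] by blast
    qed
    then show "S \<in> P"
      using S' by (simp add: P_def)
  qed
  moreover have "G \<subseteq> P"
    using G by (auto simp: P_def)
  ultimately have "coproductive_hull U C G \<subseteq> P"
    unfolding coproductive_hull_def by blast
  then show ?thesis
    using X by (auto simp: P_def)
qed

lemma le_part_full_sub: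
  "\<lbrakk>shift_stable C D; fst v \<subseteq> D\<rbrakk>
    \<Longrightarrow> le_part (full_sub C D) v i = {X \<in> Ob C. shift C (- i) X \<in> fst v}"
  unfolding le_part_def by (rule shift_image_full_sub[OF Sh_bij])

lemma ge_part_full_sub:
  "\<lbrakk>shift_stable C D; snd v \<subseteq> D\<rbrakk>
    \<Longrightarrow> ge_part (full_sub C D) v i = {X \<in> Ob C. shift C (- i) X \<in> snd v}"
  unfolding ge_part_def by (rule shift_image_full_sub[OF Sh_bij])

lemma full_sub_Ob: "full_sub C (Ob C) = C"
proof -
  have "(\<lambda>X Y Z f g h. X \<in> Ob C \<and> Y \<in> Ob C \<and> Z \<in> Ob C \<and> Tri C X Y Z f g h) = Tri C"
    using Tri_typed by (intro ext) blast
  then show ?thesis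
    by (simp add: full_sub_def)
qed

lemma shift_stable_Ob: "shift_stable C (Ob C)"
  using bij_betw_imp_surj_on[OF Sh_bij] Sh_Ob by (auto simp: shift_stable_def)

lemma ge_part_C:
  "snd v \<subseteq> Ob C \<Longrightarrow> ge_part C v i = {X \<in> Ob C. shift C (- i) X \<in> snd v}"
  using ge_part_full_sub[OF shift_stable_Ob, of v i] by (simp add: full_sub_Ob)

end

section \<open>Strict orthogonality\<close>

locale orthogonal_structures = triangulated_category C
  for C :: "('o, 'm) tcat" +
  fixes C0 C' :: "'o set"
    and U :: "'i set set"
    and w0 w t :: "'o set \<times> 'o set"
  assumes C0: "triangulated_subcategory C C0"
    and C': "triangulated_subcategory C C'"
    and w0: "weight_structure (full_sub C C0) w0"
    and w: "coproductive_extension U C w0 w"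
    and t: "t_structure (full_sub C C') t"
    and orth: "orthogonal_to C C' t w0"
begin

lemma C0_Ob: "X \<in> C0 \<Longrightarrow> X \<in> Ob C" and C'_Ob: "X \<in> C' \<Longrightarrow> X \<in> Ob C"
  using triangulated_subcategory_shift_stable[OF C0] triangulated_subcategory_shift_stable[OF C']
  by (auto simp: shift_stable_def)

lemma C0_stable: "shift_stable C C0" and C'_stable: "shift_stable C C'"
  using C0 C' by (auto intro: triangulated_subcategory_shift_stable)

lemma shift_C': "X \<in> C' \<Longrightarrow> shift C i X \<in> C'"
  using shift_mem_shift_stable[OF Sh_bij C'_stable] C'_Ob by blast

lemma w0_C0: "fst w0 \<subseteq> C0" "snd w0 \<subseteq> C0"
  using w0 by (auto simp: weight_structure_def retract_closed_def full_sub_simps)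

lemma w0_Ob: "X \<in> fst w0 \<Longrightarrow> X \<in> Ob C" "X \<in> snd w0 \<Longrightarrow> X \<in> Ob C"
  using w0_C0 C0_Ob by auto

lemma t_C': "fst t \<subseteq> C'" "snd t \<subseteq> C'"
  using t by (auto simp: t_structure_def iso_closed_def full_sub_simps)

lemma t_Ob: "X \<in> fst t \<Longrightarrow> X \<in> Ob C" "X \<in> snd t \<Longrightarrow> X \<in> Ob C"
  using t_C' C'_Ob by auto

lemma t_iso:
  assumes "isomorphic C X Y" "Y \<in> C'"
  shows "X \<in> fst t \<Longrightarrow> Y \<in> fst t" "X \<in> snd t \<Longrightarrow> Y \<in> snd t"
  using t assms
  by (auto simp: t_structure_def iso_closed_def full_sub_simps isomorphic_full_sub)

lemma nonneg_shift_mem: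
  assumes "\<And>X. X \<in> P \<Longrightarrow> X \<in> Ob C" "\<And>X. X \<in> P \<Longrightarrow> shift C 1 X \<in> P" "X \<in> P" "0 \<le> i"
  shows "shift C i X \<in> P"
  using \<open>0 \<le> i\<close>
proof (induction i rule: int_ge_induct)
  case base
  show ?case using assms by simp
next
  case (step i)
  then show ?case
    using assms(2)[OF step(2)] shift_add[of X 1 i] assms by (simp add: add.commute)
qed

lemma nonpos_shift_mem:
  assumes "\<And>X. X \<in> P \<Longrightarrow> X \<in> Ob C" "\<And>X. X \<in> P \<Longrightarrow> shift C (- 1) X \<in> P" "X \<in> P" "i \<le> 0"
  shows "shift C i X \<in> P"
  using \<open>i \<le> 0\<close>
proof (induction i rule: int_le_induct)
  case base
  show ?case using assms by simp
next
  case (step i)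
  then show ?case
    using assms(2)[OF step(2)] shift_add[of X "- 1" i] assms by simp
qed

lemma t_shift_fst:
  assumes "Y \<in> fst t" "i \<le> 0"
  shows "shift C i Y \<in> fst t"
proof (rule nonpos_shift_mem)
  fix Y assume "Y \<in> fst t"
  then have "Y \<in> le_part (full_sub C C') t 1"
    using t by (auto simp: t_structure_def)
  then show "shift C (- 1) Y \<in> fst t"
    by (simp add: le_part_full_sub[OF C'_stable t_C'(1)])
qed (use assms t_Ob in auto)

lemma t_shift_snd:
  assumes "Y \<in> snd t" "0 \<le> i"
  shows "shift C i Y \<in> snd t"
proof -
  have "shift C 1 Y \<in> snd t" if "Y \<in> snd t" for Y
  proof -
    have "shift C 1 Y \<in> ge_part (full_sub C C') t 1"
      using that t_Ob by (simp add: ge_part_full_sub[OF C'_stable t_C'(2)] shift_add shift_Ob)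
    then show ?thesis
      using t by (auto simp: t_structure_def)
  qed
  then show ?thesis
    using assms t_Ob nonneg_shift_mem[of "snd t"] by blast
qed

lemma le_w0_perp:
  assumes X: "X \<in> fst w0" and Y: "Y \<in> snd t" and i: "1 \<le> i"
  shows "perp C X (shift C i Y)"
proof -
  have "shift C (- 1) (shift C i Y) \<in> snd t"
    using t_shift_snd[OF Y, of "i - 1"] i t_Ob(2)[OF Y] by (simp add: shift_add)
  then have "shift C i Y \<in> ge_part (full_sub C C') t 1"
    using t_Ob(2)[OF Y] by (simp add: ge_part_full_sub[OF C'_stable t_C'(2)] shift_Ob)
  then show ?thesis
    using orth X by (auto simp: orthogonal_to_def class_perp_def)
qed

lemma ge_w0_perp:
  assumes X: "X \<in> snd w0" and Y: "Y \<in> fst t" and i: "i \<le> - 1"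
  shows "perp C X (shift C i Y)"
proof -
  have "shift C 1 (shift C i Y) \<in> fst t"
    using t_shift_fst[OF Y, of "1 + i"] i t_Ob(1)[OF Y] by (simp add: shift_add)
  then have "shift C i Y \<in> le_part (full_sub C C') t (- 1)"
    using t_Ob(1)[OF Y] by (simp add: le_part_full_sub[OF C'_stable t_C'(1)] shift_Ob)
  then show ?thesis
    using orth X by (auto simp: orthogonal_to_def class_perp_def)
qed

text \<open>
  The point where the weight structure \<open>w\<close> on all of \<open>C\<close> enters. In the \<open>w\<close>-decomposition
  \<open>A \<rightarrow> Q[1] \<rightarrow> B\<close>, the term \<open>A\<close> has no maps to \<open>Q[1]\<close> by the first assumption and
  \<open>B\<close> has none by the second, so \<open>C(Q[1], Q[1]) = 0\<close>.
\<close>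

lemma weights_detect_zero:
  assumes Q: "Q \<in> Ob C"
    and le: "\<And>X. X \<in> fst w0 \<Longrightarrow> perp C X (shift C 1 Q)"
    and ge: "\<And>X. X \<in> snd w0 \<Longrightarrow> perp C X Q"
  shows "perp C Q Q"
proof -
  let ?Q = "shift C 1 Q"
  have w': "weight_structure C w" "fst w = coproductive_hull U C (fst w0)"
      "snd w = coproductive_hull U C (snd w0)"
    using w by (auto simp: coproductive_extension_def)
  obtain A B f g h where T: "Tri C A ?Q B f g h" and A: "A \<in> fst w" and B: "B \<in> ge_part C w 1"
    using w'(1) shift_Ob[OF Q] unfolding weight_structure_def by blast
  have "perp C A ?Q"
    using coproductive_hull_perp[OF shift_Ob[OF Q] _ le] A w'(2) w0_Ob(1) by blast
  moreover have "perp C B ?Q"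
  proof -
    have "snd w \<subseteq> Ob C"
      using w'(1) by (auto simp: weight_structure_def retract_closed_def)
    then have B': "B \<in> Ob C" "shift C (- 1) B \<in> snd w"
      using B by (simp_all add: ge_part_C)
    have "perp C (shift C (- 1) B) Q"
      using coproductive_hull_perp[OF Q _ ge] B'(2) w'(3) w0_Ob(2) by blast
    then show ?thesis
      using B' Q by (simp add: perp_shift_left)
  qed
  ultimately have "perp C ?Q ?Q"
    using perp_middle_left[OF T] shift_Ob[OF Q] by blast
  then show ?thesis
    using Q by (simp add: perp_shift_shift)
qed

lemma truncation:
  assumes "M \<in> C'"
  obtains L R f g h where "Tri C L M R f g h" "L \<in> snd t" "R \<in> C'" "shift C 1 R \<in> fst t"
proof -
  obtain L R f g h where T: "Tri (full_sub C C') L M R f g h" "L \<in> snd t"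
      "R \<in> le_part (full_sub C C') t (- 1)"
    using t assms unfolding t_structure_def by (metis full_sub_simps)
  then have "shift C 1 R \<in> fst t"
    by (simp add: le_part_full_sub[OF C'_stable t_C'(1)])
  then show thesis
    using that T unfolding full_sub_simps by blast
qed

text \<open>
  Together with \<open>perp_w0_imp_fst\<close>, this is the nontrivial half of strict orthogonality. Here
  \<open>R\<close> inherits from \<open>M\<close> and \<open>L[1]\<close> the orthogonality to the negative weights, so \<open>R\<close> is zero and
  \<open>M\<close> is isomorphic to \<open>L\<close>.
\<close>

lemma perp_w0_imp_snd:
  assumes M: "M \<in> C'" and perp: "\<And>X. X \<in> fst w0 \<Longrightarrow> perp C X (shift C 1 M)"
  shows "M \<in> snd t"
proof -
  obtain L R f g h where T: "Tri C L M R f g h" and L: "L \<in> snd t"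
    and R: "R \<in> C'" "shift C 1 R \<in> fst t"
    using truncation[OF M] .
  note ty = Tri_typed[OF T]
  have "perp C R R"
  proof (rule weights_detect_zero)
    fix X assume X: "X \<in> fst w0"
    then have "perp C (shift C (- 1) X) M" "perp C (shift C (- 1) (shift C (- 1) X)) L"
      using perp[OF X] le_w0_perp[OF X L, of 2] w0_Ob(1) ty
      by (simp_all add: perp_shift_left shift_add shift_Ob)
    then show "perp C X (shift C 1 R)"
      using perp_cone[OF T, of "shift C (- 1) X"] X w0_Ob(1) ty
      by (simp add: perp_shift_left shift_Ob)
  next
    fix X assume "X \<in> snd w0"
    then show "perp C X R"
      using ge_w0_perp[OF _ R(2), of X "- 1"] ty by (simp add: shift_add)
  qed (use ty in blast)
  then show ?thesis
    using Tri_zero_third_imp_isomorphic[OF T] L M t_iso(2) by blast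
qed

text \<open>
  Now \<open>L\<close> inherits from \<open>M\<close> and \<open>R[-1]\<close> the orthogonality to the nonnegative weights, so \<open>L\<close> is zero
  and \<open>M\<close> is isomorphic to \<open>R\<close>.
\<close>

lemma perp_w0_imp_fst:
  assumes M: "M \<in> C'" and perp: "\<And>X. X \<in> snd w0 \<Longrightarrow> perp C X M"
  shows "shift C 1 M \<in> fst t"
proof -
  obtain L R f g h where T: "Tri C L M R f g h" and L: "L \<in> snd t"
    and R: "R \<in> C'" "shift C 1 R \<in> fst t"
    using truncation[OF M] .
  note ty = Tri_typed[OF T]
  have "perp C L L"
  proof (rule weights_detect_zero)
    fix X assume "X \<in> fst w0"
    then show "perp C X (shift C 1 L)"
      using le_w0_perp[OF _ L] by simp
  next
    fix X assume X: "X \<in> snd w0"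
    then have "perp C (shift C 1 X) R"
      using ge_w0_perp[OF _ R(2), of X "- 2"] w0_Ob(2) ty
      by (simp add: perp_shift_left shift_add)
    then show "perp C X L"
      using perp_fibre[OF T] X w0_Ob(2) perp by blast
  qed (use ty in blast)
  then have "isomorphic C M R"
    by (rule Tri_zero_first_imp_isomorphic[OF T])
  then have "isomorphic C R M"
    by (rule isomorphic_sym)
  then have "isomorphic C (shift C 1 R) (shift C 1 M)"
    using isomorphic_Sh ty by (simp add: shift_1)
  then show ?thesis
    using R M shift_C' t_iso(1) by blast
qed

section \<open>Subcategories cut out by vanishing of Hom\<close>

lemma right_degenerate_iff:
  "right_degenerate (full_sub C C0) w0 X \<longleftrightarrow> X \<in> Ob C \<and> (\<forall>i. shift C i X \<in> fst w0)"
  unfolding right_degenerate_def le_part_full_sub[OF C0_stable w0_C0(1)]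
  by (auto dest: spec[of _ "- _ :: int"])

lemma left_degenerate_iff:
  "left_degenerate (full_sub C C0) w0 X \<longleftrightarrow> X \<in> Ob C \<and> (\<forall>i. shift C i X \<in> snd w0)"
  unfolding left_degenerate_def ge_part_full_sub[OF C0_stable w0_C0(2)]
  by (auto dest: spec[of _ "- _ :: int"])

text \<open>
  Every shift of a right degenerate object has nonpositive weights, hence so does the one by which
  orthogonality has to be applied. The dual holds for left degenerate objects.
\<close>

lemma right_degenerate_perp:
  assumes X: "right_degenerate (full_sub C C0) w0 X" and L: "L \<in> snd t"
  shows "perp C (shift C i X) L"
  using le_w0_perp[of "shift C (i + 1) X", OF _ L, of 1] X t_Ob(2)[OF L]
    perp_shift_left[of "shift C (i + 1) X" L "- 1"]
  by (simp add: right_degenerate_iff shift_add shift_Ob)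

lemma left_degenerate_perp:
  assumes X: "left_degenerate (full_sub C C0) w0 X" and R: "R \<in> fst t"
  shows "perp C (shift C i X) R"
  using ge_w0_perp[of "shift C (i - 1) X", OF _ R, of "- 1"] X t_Ob(1)[OF R]
    perp_shift_left[of "shift C (i - 1) X" R 1]
  by (simp add: left_degenerate_iff shift_add shift_Ob)

text \<open>
  The filter says for which indices \<open>H\<^sup>i(X) = C(X[-i], M)\<close> has to vanish: \<open>at_bot\<close> gives
  the plus part, \<open>at_top\<close> the minus part, and their supremum the bounded part.
\<close>

definition vanishing_part :: "int filter \<Rightarrow> 'o set" where
  "vanishing_part F =
     {M \<in> C'. \<forall>X \<in> C0. eventually (\<lambda>i. perp C (shift C (- i) X) M) F}"

lemma vanishing_partD:
  "\<lbrakk>M \<in> vanishing_part F; X \<in> C0\<rbrakk> \<Longrightarrow> eventually (\<lambda>i. perp C (shift C (- i) X) M) F"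
  by (simp add: vanishing_part_def)

text \<open>
  What makes \<open>vanishing_part F\<close> stable under shifts and cones, as shifting \<open>M\<close> or passing to the
  connecting map changes the index \<open>i\<close> by a constant.
\<close>

definition translation_invariant :: "int filter \<Rightarrow> bool" where
  "translation_invariant F \<longleftrightarrow>
     (\<forall>P k. eventually P F \<longrightarrow> eventually (\<lambda>i. P (i + k)) F)"

lemma translation_invariant_at_bot: "translation_invariant at_bot"
  unfolding translation_invariant_def eventually_at_bot_linorder
  by (metis add_le_cancel_right diff_add_cancel)

lemma translation_invariant_at_top: "translation_invariant at_top"
  unfolding translation_invariant_def eventually_at_top_linorder
  by (metis add_le_cancel_right diff_add_cancel)

lemma translation_invariant_sup:
  "\<lbrakk>translation_invariant F; translation_invariant G\<rbrakk> \<Longrightarrow> translation_invariant (sup F G)"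
  by (simp add: translation_invariant_def eventually_sup)

lemma vanishing_part_sup: "vanishing_part (sup F G) = vanishing_part F \<inter> vanishing_part G"
  by (auto simp: vanishing_part_def eventually_sup)

lemma locally_bounded_below_iff:
  "locally_bounded_below (full_sub C C0) (\<lambda>X. hom_group C X M) \<longleftrightarrow>
     (\<forall>X \<in> C0. eventually (\<lambda>i. perp C (shift C (- i) X) M) at_bot)"
  using shift_full_sub[OF Sh_bij C0_stable]
  by (simp add: locally_bounded_below_def eventually_at_bot_dense full_sub_simps hom_group_def perp_def)

lemma locally_bounded_above_iff:
  "locally_bounded_above (full_sub C C0) (\<lambda>X. hom_group C X M) \<longleftrightarrow>
     (\<forall>X \<in> C0. eventually (\<lambda>i. perp C (shift C (- i) X) M) at_top)"
  using shift_full_sub[OF Sh_bij C0_stable]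
  by (simp add: locally_bounded_above_def eventually_at_top_dense full_sub_simps hom_group_def perp_def)

lemma plus_part_eq: "plus_part C C0 C' = vanishing_part at_bot"
  by (simp add: plus_part_def vanishing_part_def locally_bounded_below_iff)

lemma minus_part_eq: "minus_part C C0 C' = vanishing_part at_top"
  by (simp add: minus_part_def vanishing_part_def locally_bounded_above_iff)

lemma bounded_part_eq: "bounded_part C C0 C' = vanishing_part (sup at_bot at_top)"
  by (auto simp: bounded_part_def vanishing_part_def locally_bounded_below_iff
      locally_bounded_above_iff eventually_sup)

lemma eventually_translate:
  "translation_invariant F \<Longrightarrow> eventually P F \<Longrightarrow> eventually (\<lambda>i. P (i + k)) F"
  by (simp add: translation_invariant_def)

lemma vanishing_part_cone:
  assumes F: "translation_invariant F" and T: "Tri C X Y Z f g h"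
    and X: "X \<in> vanishing_part F" and Y: "Y \<in> vanishing_part F"
  shows "Z \<in> vanishing_part F"
proof -
  have "eventually (\<lambda>i. perp C (shift C (- i) A) Z) F" if A: "A \<in> C0" for A
    using vanishing_partD[OF Y A] eventually_translate[OF F vanishing_partD[OF X A], of 1]
    by eventually_elim
      (use A in \<open>auto intro!: perp_cone[OF T] simp: shift_Ob C0_Ob shift_add algebra_simps\<close>)
  moreover have "Z \<in> C'"
    using C' T X Y unfolding triangulated_subcategory_def vanishing_part_def by blast
  ultimately show ?thesis
    by (simp add: vanishing_part_def)
qed

lemma vanishing_part_fibre:
  assumes F: "translation_invariant F" and T: "Tri C X Y Z f g h"
    and Y: "Y \<in> vanishing_part F" and Z: "Z \<in> vanishing_part F" and X: "X \<in> C'"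
  shows "X \<in> vanishing_part F"
proof -
  have "eventually (\<lambda>i. perp C (shift C (- i) A) X) F" if A: "A \<in> C0" for A
    using vanishing_partD[OF Y A] eventually_translate[OF F vanishing_partD[OF Z A], of "- 1"]
    by eventually_elim
      (use A in \<open>auto intro!: perp_fibre[OF T] simp: shift_Ob C0_Ob shift_add\<close>)
  then show ?thesis
    using X by (simp add: vanishing_part_def)
qed

lemma vanishing_part_shift:
  assumes F: "translation_invariant F" and M: "M \<in> vanishing_part F"
  shows "shift C k M \<in> vanishing_part F"
proof -
  have "eventually (\<lambda>i. perp C (shift C (- i) A) (shift C k M)) F" if A: "A \<in> C0" for A
    using eventually_translate[OF F vanishing_partD[OF M A], of k]
  proof eventually_elim
    case (elim i)
    have "M \<in> Ob C"
      using M C'_Ob by (auto simp: vanishing_part_def)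
    then show ?case
      using elim A C0_Ob perp_shift_left[of "shift C (- i) A" M "- k"]
      by (simp add: shift_add shift_Ob add.commute)
  qed
  then show ?thesis
    using M shift_C' by (auto simp: vanishing_part_def)
qed

lemma vanishing_part_iso:
  assumes M: "M \<in> vanishing_part F" and iso: "isomorphic C M N" and N: "N \<in> C'"
  shows "N \<in> vanishing_part F"
proof -
  have "eventually (\<lambda>i. perp C (shift C (- i) A) N) F" if A: "A \<in> C0" for A
    using vanishing_partD[OF M A]
  proof eventually_elim
    case (elim i)
    have "M \<in> Ob C"
      using M C'_Ob by (auto simp: vanishing_part_def)
    then show ?case
      using perp_retract_right[OF elim isomorphic_imp_retract[OF isomorphic_sym[OF iso]]]
        A N C'_Ob C0_Ob shift_Ob by blast
  qed
  then show ?thesis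
    using N by (simp add: vanishing_part_def)
qed

lemma zero_in_vanishing_part:
  assumes "perp C Z Z" "Z \<in> C'"
  shows "Z \<in> vanishing_part F"
  using assms zero_perp_right[OF assms(1)] C'_Ob C0_Ob shift_Ob
  by (auto simp: vanishing_part_def)

lemma vanishing_part_stable:
  assumes F: "translation_invariant F"
  shows "shift_stable C (vanishing_part F)"
  unfolding shift_stable_def
proof (intro conjI ballI)
  show "vanishing_part F \<subseteq> Ob C"
    using C'_Ob by (auto simp: vanishing_part_def)
  fix X assume X: "X \<in> Ob C"
  show "Sh C X \<in> vanishing_part F \<longleftrightarrow> X \<in> vanishing_part F"
    using vanishing_part_shift[OF F, of "shift C 1 X" "- 1"] vanishing_part_shift[OF F, of X 1] X
    by (auto simp: shift_add shift_1[symmetric])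
qed

lemma vanishing_part_triangulated:
  assumes F: "translation_invariant F"
  shows "triangulated_subcategory (full_sub C C') (vanishing_part F)"
  unfolding triangulated_subcategory_def
proof (intro conjI)
  show "iso_closed (full_sub C C') (vanishing_part F)"
    using vanishing_part_iso
    by (auto simp: iso_closed_def full_sub_simps isomorphic_full_sub vanishing_part_def)
  show "\<forall>Z. zero_object (full_sub C C') Z \<longrightarrow> Z \<in> vanishing_part F"
  proof (intro allI impI)
    fix Z assume "zero_object (full_sub C C') Z"
    then have "Z \<in> C'" "\<exists>!f. f \<in> Hom C Z Z"
      by (auto simp: zero_object_def full_sub_simps)
    then show "Z \<in> vanishing_part F"
      using C'_Ob Zero_Hom by (intro zero_in_vanishing_part perpI) auto
  qed
  show "\<forall>X\<in>Ob (full_sub C C'). Sh (full_sub C C') X \<in> vanishing_part F \<longleftrightarrow> X \<in> vanishing_part F"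
    using vanishing_part_stable[OF F] C'_Ob by (auto simp: shift_stable_def full_sub_simps)
  show "\<forall>X Y Z f g h. Tri (full_sub C C') X Y Z f g h \<and> X \<in> vanishing_part F \<and> Y \<in> vanishing_part F
      \<longrightarrow> Z \<in> vanishing_part F"
    using vanishing_part_cone[OF F] by (auto simp: full_sub_simps)
qed

section \<open>Truncation preserves boundedness\<close>

text \<open>
  The two facts about \<open>vanishing_part F\<close> that depend on the boundedness of \<open>w0\<close>. They
  are isolated here because they pass to suprema of filters, where \<open>vanishing_part\<close>
  becomes an intersection.
\<close>

definition truncation_stable :: "int filter \<Rightarrow> bool" where
  "truncation_stable F \<longleftrightarrow> heart t \<subseteq> vanishing_part F \<and>
     (\<forall>L M R f g h. Tri C L M R f g h \<and> L \<in> snd t \<and> shift C 1 R \<in> fst t \<and> M \<in> vanishing_part F \<longrightarrow>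
        L \<in> vanishing_part F \<and> R \<in> vanishing_part F)"

lemma truncation_stable_sup:
  "\<lbrakk>truncation_stable F; truncation_stable G\<rbrakk> \<Longrightarrow> truncation_stable (sup F G)"
  unfolding truncation_stable_def vanishing_part_sup by blast

text \<open>
  Essential boundedness reduces the test on all of \<open>C0\<close> to right degenerate objects: up to a
  shift, each object of \<open>C0\<close> is a retract of an extension of an object of nonnegative weights by a
  right degenerate one, and orthogonality gives the vanishing on the former.
\<close>

lemma vanishing_part_at_botI:
  assumes b: "essentially_bounded_below (full_sub C C0) w0"
    and R: "R \<in> fst t"
    and RD: "\<And>D. right_degenerate (full_sub C C0) w0 D \<Longrightarrow>
      eventually (\<lambda>i. perp C (shift C (- i) D) R) at_bot"
  shows "R \<in> vanishing_part at_bot"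
proof -
  have R': "R \<in> Ob C"
    using R t_Ob by blast
  have "eventually (\<lambda>i. perp C (shift C (- i) A) R) at_bot" if A: "A \<in> C0" for A
  proof -
    obtain n where n: "essentially_positive (full_sub C C0) w0 (shift C (- n) A)"
      using b A shift_full_sub[OF Sh_bij C0_stable A]
      by (auto simp: essentially_bounded_below_def full_sub_simps)
    let ?A = "shift C (- n) A"
    obtain S D Y f g h where S: "retract_of C ?A S" and T: "Tri C D S Y f g h"
      and Y: "Y \<in> snd w0" and D: "right_degenerate (full_sub C C0) w0 D"
      using n unfolding essentially_positive_def full_sub_simps
      by (blast dest: direct_summand_retract)
    note ty = Tri_typed[OF T]
    have "eventually (\<lambda>i::int. i \<le> - 1) at_bot"
      by (rule eventually_le_at_bot)
    then have "eventually (\<lambda>i. perp C (shift C (- i) ?A) R) at_bot"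
      using RD[OF D]
    proof eventually_elim
      case (elim i)
      have "perp C Y (shift C i R)"
        using ge_w0_perp[OF Y R] elim by blast
      moreover have "perp C D (shift C i R)"
        using elim ty R' by (simp add: perp_shift_left)
      ultimately have "perp C S (shift C i R)"
        using perp_middle_left[OF T] R' shift_Ob by blast
      then have "perp C ?A (shift C i R)"
        using perp_retract_left[OF _ S] ty R' A C0_Ob shift_Ob by blast
      then show ?case
        using R' A C0_Ob by (simp add: perp_shift_left shift_Ob)
    qed
    then show ?thesis
      using eventually_translate[OF translation_invariant_at_bot, of _ "- n"] A C0_Ob
      by (fastforce simp: shift_add)
  qed
  then show ?thesis
    using R t_C' by (auto simp: vanishing_part_def)
qed

lemma vanishing_part_at_topI:
  assumes b: "essentially_bounded_above (full_sub C C0) w0"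
    and L: "L \<in> snd t"
    and LD: "\<And>D. left_degenerate (full_sub C C0) w0 D \<Longrightarrow>
      eventually (\<lambda>i. perp C (shift C (- i) D) L) at_top"
  shows "L \<in> vanishing_part at_top"
proof -
  have L': "L \<in> Ob C"
    using L t_Ob by blast
  have "eventually (\<lambda>i. perp C (shift C (- i) A) L) at_top" if A: "A \<in> C0" for A
  proof -
    obtain n where n: "essentially_negative (full_sub C C0) w0 (shift C (- n) A)"
      using b A shift_full_sub[OF Sh_bij C0_stable A]
      by (auto simp: essentially_bounded_above_def full_sub_simps)
    let ?A = "shift C (- n) A"
    obtain S D X f g h where S: "retract_of C ?A S" and T: "Tri C X S D f g h"
      and X: "X \<in> fst w0" and D: "left_degenerate (full_sub C C0) w0 D"
      using n unfolding essentially_negative_def full_sub_simps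
      by (blast dest: direct_summand_retract)
    note ty = Tri_typed[OF T]
    have "eventually (\<lambda>i::int. 1 \<le> i) at_top"
      by (rule eventually_ge_at_top)
    then have "eventually (\<lambda>i. perp C (shift C (- i) ?A) L) at_top"
      using LD[OF D]
    proof eventually_elim
      case (elim i)
      have "perp C X (shift C i L)"
        using le_w0_perp[OF X L] elim by blast
      moreover have "perp C D (shift C i L)"
        using elim ty L' by (simp add: perp_shift_left)
      ultimately have "perp C S (shift C i L)"
        using perp_middle_left[OF T] L' shift_Ob by blast
      then have "perp C ?A (shift C i L)"
        using perp_retract_left[OF _ S] ty L' A C0_Ob shift_Ob by blast
      then show ?case
        using L' A C0_Ob by (simp add: perp_shift_left shift_Ob)
    qed
    then show ?thesis
      using eventually_translate[OF translation_invariant_at_top, of _ "- n"] A C0_Ob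
      by (fastforce simp: shift_add)
  qed
  then show ?thesis
    using L t_C' by (auto simp: vanishing_part_def)
qed

text \<open>
  On a right degenerate \<open>D\<close> the functors represented by \<open>M\<close> and \<open>R\<close> agree, because those
  represented by \<open>L\<close> and \<open>L[1]\<close> vanish on all shifts of \<open>D\<close>. So the criterion
  \<open>vanishing_part_at_botI\<close> for \<open>R\<close> follows from the boundedness of \<open>M\<close>, applied to \<open>D\<close> itself. Objects of
  the heart pass the criterion since they are in \<open>C'_{t \<ge> 0}\<close>.
\<close>

lemma truncation_stable_at_bot:
  assumes b: "essentially_bounded_below (full_sub C C0) w0"
  shows "truncation_stable at_bot"
  unfolding truncation_stable_def
proof (intro conjI allI impI; (elim conjE)?)
  show "heart t \<subseteq> vanishing_part at_bot"
    using right_degenerate_perp by (auto simp: heart_def intro!: vanishing_part_at_botI[OF b])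
  fix L M R f g h
  assume T: "Tri C L M R f g h" and L: "L \<in> snd t" and R: "shift C 1 R \<in> fst t"
    and M: "M \<in> vanishing_part at_bot"
  note ty = Tri_typed[OF T]
  have R0: "R \<in> fst t"
    using t_shift_fst[OF R, of "- 1"] ty shift_add[of R "- 1" 1] by simp
  show R_van: "R \<in> vanishing_part at_bot"
  proof (rule vanishing_part_at_botI[OF b R0])
    fix D assume D: "right_degenerate (full_sub C C0) w0 D"
    have "D \<in> C0"
      using D w0_C0 by (force simp: right_degenerate_iff dest: spec[of _ 0])
    show "eventually (\<lambda>i. perp C (shift C (- i) D) R) at_bot"
      using vanishing_partD[OF M \<open>D \<in> C0\<close>]
      by eventually_elim
        (use \<open>D \<in> C0\<close> in \<open>auto intro!: perp_cone[OF T] right_degenerate_perp[OF D L]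
          simp: shift_Ob C0_Ob shift_add\<close>)
  qed
  show "L \<in> vanishing_part at_bot"
    using vanishing_part_fibre[OF translation_invariant_at_bot T M R_van] L t_C' by blast
qed

text \<open>
  Dually, on a left degenerate object the functors represented by \<open>L\<close> and \<open>M\<close> agree.
\<close>

lemma truncation_stable_at_top:
  assumes b: "essentially_bounded_above (full_sub C C0) w0"
  shows "truncation_stable at_top"
  unfolding truncation_stable_def
proof (intro conjI allI impI; (elim conjE)?)
  show "heart t \<subseteq> vanishing_part at_top"
    using left_degenerate_perp by (auto simp: heart_def intro!: vanishing_part_at_topI[OF b])
  fix L M R f g h
  assume T: "Tri C L M R f g h" and L: "L \<in> snd t" and R: "shift C 1 R \<in> fst t"
    and M: "M \<in> vanishing_part at_top"
  note ty = Tri_typed[OF T]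
  have R0: "R \<in> fst t"
    using t_shift_fst[OF R, of "- 1"] ty shift_add[of R "- 1" 1] by simp
  show L_van: "L \<in> vanishing_part at_top"
  proof (rule vanishing_part_at_topI[OF b L])
    fix D assume D: "left_degenerate (full_sub C C0) w0 D"
    have "D \<in> C0"
      using D w0_C0 by (force simp: left_degenerate_iff dest: spec[of _ 0])
    show "eventually (\<lambda>i. perp C (shift C (- i) D) L) at_top"
      using vanishing_partD[OF M \<open>D \<in> C0\<close>]
      by eventually_elim
        (use \<open>D \<in> C0\<close> in \<open>auto intro!: perp_fibre[OF T] left_degenerate_perp[OF D R0]
          simp: shift_Ob C0_Ob shift_add\<close>)
  qed
  show "R \<in> vanishing_part at_top"
    by (rule vanishing_part_cone[OF translation_invariant_at_top T L_van M])
qed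


section \<open>Restriction of the t-structure\<close>

lemma strictly_orthogonal_restriction:
  assumes D: "shift_stable C D" "D \<subseteq> C'"
  shows "strictly_orthogonal_to C D (t_restriction t D) w0"
proof -
  let ?t = "t_restriction t D"
  have sub: "fst ?t \<subseteq> D" "snd ?t \<subseteq> D"
    by (auto simp: t_restriction_def)
  have mem: "shift C i X \<in> D \<longleftrightarrow> X \<in> D" if "X \<in> Ob C" for i X
    using shift_mem_shift_stable[OF Sh_bij D(1) that] .
  have DOb: "X \<in> Ob C" if "X \<in> D" for X
    using that D C'_Ob by blast
  have "ge_part (full_sub C D) ?t 1 = {X \<in> D. shift C (- 1) X \<in> snd t}"
    unfolding ge_part_full_sub[OF D(1) sub(2)] using mem DOb by (auto simp: t_restriction_def)
  moreover have "shift C (- 1) X \<in> snd t \<longleftrightarrow> X \<in> right_perp C (fst w0)" if X: "X \<in> D" for X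
  proof
    assume "shift C (- 1) X \<in> snd t"
    then show "X \<in> right_perp C (fst w0)"
      using le_w0_perp[of _ "shift C (- 1) X" 1] DOb[OF X] by (simp add: right_perp_def shift_add)
  next
    assume "X \<in> right_perp C (fst w0)"
    then show "shift C (- 1) X \<in> snd t"
      using DOb[OF X] D X shift_C'
      by (intro perp_w0_imp_snd) (auto simp: right_perp_def shift_add)
  qed
  ultimately have ge: "ge_part (full_sub C D) ?t 1 = right_perp C (fst w0) \<inter> D"
    by blast
  have "le_part (full_sub C D) ?t (- 1) = {X \<in> D. shift C 1 X \<in> fst t}"
    unfolding le_part_full_sub[OF D(1) sub(1)] using mem DOb by (auto simp: t_restriction_def)
  moreover have "shift C 1 X \<in> fst t \<longleftrightarrow> X \<in> right_perp C (snd w0)" if X: "X \<in> D" for X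
  proof
    assume "shift C 1 X \<in> fst t"
    then show "X \<in> right_perp C (snd w0)"
      using ge_w0_perp[of _ "shift C 1 X" "- 1"] DOb[OF X] by (simp add: right_perp_def shift_add)
  next
    assume "X \<in> right_perp C (snd w0)"
    then show "shift C 1 X \<in> fst t"
      using D X by (intro perp_w0_imp_fst) (auto simp: right_perp_def)
  qed
  ultimately have "le_part (full_sub C D) ?t (- 1) = right_perp C (snd w0) \<inter> D"
    by blast
  with ge show ?thesis
    by (simp add: strictly_orthogonal_to_def)
qed

lemma t_restricts_to_vanishing_part:
  assumes F: "translation_invariant F" and stable: "truncation_stable F"
  shows "t_restricts_to (full_sub C C') t (vanishing_part F)"
proof -
  let ?D = "vanishing_part F"
  let ?t = "t_restriction t ?D"
  let ?E = "full_sub C ?D"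
  have D: "shift_stable C ?D" "?D \<subseteq> C'"
    using vanishing_part_stable[OF F] by (auto simp: vanishing_part_def)
  have sub: "fst ?t \<subseteq> ?D" "snd ?t \<subseteq> ?D"
    by (auto simp: t_restriction_def)
  have mem: "shift C i X \<in> ?D \<longleftrightarrow> X \<in> ?D" if "X \<in> Ob C" for i X
    using shift_mem_shift_stable[OF Sh_bij D(1) that] .
  have DOb: "X \<in> Ob C" if "X \<in> ?D" for X
    using that D C'_Ob by blast
  have le: "le_part ?E ?t i = {X \<in> ?D. shift C (- i) X \<in> fst t}" for i
    unfolding le_part_full_sub[OF D(1) sub(1)] using mem DOb by (auto simp: t_restriction_def)
  have ge: "ge_part ?E ?t i = {X \<in> ?D. shift C (- i) X \<in> snd t}" for i
    unfolding ge_part_full_sub[OF D(1) sub(2)] using mem DOb by (auto simp: t_restriction_def)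
  have "t_structure ?E ?t"
    unfolding t_structure_def
  proof (intro conjI ballI)
    show "iso_closed ?E (fst ?t)" "iso_closed ?E (snd ?t)"
      using t_iso D(2)
      by (auto simp: iso_closed_def t_restriction_def full_sub_simps isomorphic_full_sub)
    show "fst ?t \<subseteq> le_part ?E ?t 1"
      using t_shift_fst[of _ "- 1"] unfolding le by (auto simp: t_restriction_def)
    show "ge_part ?E ?t 1 \<subseteq> snd ?t"
    proof
      fix X assume "X \<in> ge_part ?E ?t 1"
      then show "X \<in> snd ?t"
        using t_shift_snd[of "shift C (- 1) X" 1] DOb unfolding ge
        by (auto simp: t_restriction_def shift_add)
    qed
    have "ge_part ?E ?t 1 \<subseteq> ge_part (full_sub C C') t 1"
      unfolding ge ge_part_full_sub[OF C'_stable t_C'(2)] using DOb by auto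
    then show "class_perp ?E (ge_part ?E ?t 1) (fst ?t)"
      using t by (auto simp: t_structure_def class_perp_def perp_def full_sub_simps t_restriction_def)
    fix M assume "M \<in> Ob ?E"
    then have M: "M \<in> ?D"
      by (simp add: full_sub_simps)
    then have "M \<in> C'"
      using D(2) by blast
    then obtain L R f g h where T: "Tri C L M R f g h" "L \<in> snd t" "R \<in> C'" "shift C 1 R \<in> fst t"
      by (rule truncation)
    then have "L \<in> ?D" "R \<in> ?D"
      using stable M unfolding truncation_stable_def by blast+
    then have "Tri ?E L M R f g h \<and> L \<in> snd ?t \<and> R \<in> le_part ?E ?t (- 1)"
      using T M unfolding le by (simp add: full_sub_simps t_restriction_def)
    then show "\<exists>L R f g h. Tri ?E L M R f g h \<and> L \<in> snd ?t \<and> R \<in> le_part ?E ?t (- 1)"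
      by blast
  qed
  then show ?thesis
    unfolding t_restricts_to_def full_sub_full_sub[OF D(2)] .
qed

lemma vanishing_part_restriction:
  assumes F: "translation_invariant F" and stable: "truncation_stable F"
  defines "D \<equiv> vanishing_part F"
  shows "triangulated_subcategory (full_sub C C') D \<and>
    t_restricts_to (full_sub C C') t D \<and>
    strictly_orthogonal_to C D (t_restriction t D) w0 \<and>
    heart (t_restriction t D) = heart t"
proof -
  have "D \<subseteq> C'"
    by (auto simp: D_def vanishing_part_def)
  then have "strictly_orthogonal_to C D (t_restriction t D) w0"
    using vanishing_part_stable[OF F] unfolding D_def by (intro strictly_orthogonal_restriction)
  moreover have "heart (t_restriction t D) = heart t"
    using stable by (auto simp: truncation_stable_def heart_def t_restriction_def D_def)
  ultimately show ?thesis
    using vanishing_part_triangulated[OF F] t_restricts_to_vanishing_part[OF F stable]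
    by (simp add: D_def)
qed

end

theorem theorem4p2p4:
  fixes C :: "('o, 'm) tcat"
    and C0 C' :: "'o set"
    and U :: "'i set set"
    and w0 w t :: "'o set \<times> 'o set"
  assumes "triangulated_category C"
    and "triangulated_subcategory C C0"
    and "triangulated_subcategory C C'"
    and "weight_structure (full_sub C C0) w0"
    and "coproductive_extension U C w0 w"
    and "t_structure (full_sub C C') t"
    and "orthogonal_to C C' t w0"
  shows
    "(essentially_bounded_below (full_sub C C0) w0 \<longrightarrow>
        triangulated_subcategory (full_sub C C') (plus_part C C0 C') \<and>
        t_restricts_to (full_sub C C') t (plus_part C C0 C') \<and>
        strictly_orthogonal_to C (plus_part C C0 C') (t_restriction t (plus_part C C0 C')) w0 \<and>
        heart (t_restriction t (plus_part C C0 C')) = heart t) \<and>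
     (essentially_bounded_above (full_sub C C0) w0 \<longrightarrow>
        triangulated_subcategory (full_sub C C') (minus_part C C0 C') \<and>
        t_restricts_to (full_sub C C') t (minus_part C C0 C') \<and>
        strictly_orthogonal_to C (minus_part C C0 C') (t_restriction t (minus_part C C0 C')) w0 \<and>
        heart (t_restriction t (minus_part C C0 C')) = heart t) \<and>
     (essentially_bounded_below (full_sub C C0) w0 \<and>
      essentially_bounded_above (full_sub C C0) w0 \<longrightarrow>
        triangulated_subcategory (full_sub C C') (bounded_part C C0 C') \<and>
        t_restricts_to (full_sub C C') t (bounded_part C C0 C') \<and>
        strictly_orthogonal_to C (bounded_part C C0 C') (t_restriction t (bounded_part C C0 C')) w0 \<and>
        heart (t_restriction t (bounded_part C C0 C')) = heart t)"
proof -
  interpret orthogonal_structures C C0 C' U w0 w t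
    using assms by (intro orthogonal_structures.intro orthogonal_structures_axioms.intro)
  note inv = translation_invariant_at_bot translation_invariant_at_top
  show ?thesis
    unfolding plus_part_eq minus_part_eq bounded_part_eq
    by (intro conjI impI; (elim conjE)?)
      (simp_all add: vanishing_part_restriction inv translation_invariant_sup
        truncation_stable_at_bot truncation_stable_at_top truncation_stable_sup)
qed

end
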